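(* Let $n\in\mathbb{N}$ and let $L,C,R\in\mathbb{R}_{\max}^{n\times n}$. Consider the max-plus linear system $$\forall k\geq 2,\quad \bar{x}(k+1)=\bar{A}\otimes\bar{x}(k)\oplus\bar{B}\otimes u(k),\qquad \bar{A}=\begin{bmatrix}\mathcal{E}&E\\ \mathcal{E}&\mathcal{E}\end{bmatrix}\in\mathbb{R}_{\max}^{2n\times 2n},\quad \bar{B}=\begin{bmatrix}\mathcal{E}\\ E\end{bmatrix}\in\mathbb{R}_{\max}^{2n\times n},$$ and the semimodule $$\mathcal{K}=\{\bar{x}\in\mathbb{R}_{\max}^{2n}\mid \bar{x}\geq H\otimes\bar{x}\}=\operatorname{Im}H^*,\qquad H=\begin{bmatrix}C&L\\ R&C\end{bmatrix}.$$ Let $\mathcal{K}^*$ be the maximal $(\bar{A},\bar{B})$-invariant subsemimodule of $\mathcal{K}$, and let $\phi^k$ be the iterates of the map $\phi$ associated with $(\bar A,\bar B)$. Let (P) denote the system of inequalities $$(\forall k\in\mathbb{N})\quad x(k)\geq L\otimes x(k+1),\quad x(k)\geq C\otimes x(k),\quad x(k+1)\geq R\otimes x(k).$$ Then: (1) the sequence $\{\phi^k(\mathcal{K})\}_{k\in\mathbb{N}_0}$ converges in at most $k=n^2-1$ steps (i.e. $\phi^k(\mathcal{K})=\phi^{n^2-1}(\mathcal{K})$ for all $k\geq n^2-1$) and $\mathcal{K}^*\cap\mathbb{R}^{2n}\neq\emptyset$ if and only if (P) is consistent; (2) the sequence $\{\phi^k(\mathcal{K})\cap\mathbb{R}^{2n}\}_{k\in\mathbb{N}_0}$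 does not converge in finitely many steps (i.e. is not eventually constant) and $\mathcal{K}^*\cap\mathbb{R}^{2n}=\emptyset$ if and only if (P) is weakly consistent but not consistent; (3) the sequence $\{\phi^k(\mathcal{K})\cap\mathbb{R}^{2n}\}_{k\in\mathbb{N}_0}$ converges in a finite number of steps to the empty set $\emptyset$ (i.e. there is $\hat{k}$ such that $\phi^k(\mathcal{K})\cap\mathbb{R}^{2n}=\emptyset$ for all $k\geq\hat{k}$) if and only if (P) is not weakly consistent.
   Context: Max-plus algebra: $\mathbb{R}_{\max}=\mathbb{R}\cup\{-\infty\}$, $\overline{\mathbb{R}}=\mathbb{R}\cup\{-\infty,+\infty\}$; $\mathbb{N}$ is the set of positive integers and $\mathbb{N}_0=\mathbb{N}\cup\{0\}$. For $a,b\in\overline{\mathbb{R}}$, $a\oplus b=\max\{a,b\}$, and $a\otimes b=a+b$ if $a,b\in\mathbb{R}\cup\{+\infty\}$, $a\otimes b=-\infty$ if $a$ or $b$ is $-\infty$. For matrices, $(A\oplus B)_{ij}=A_{ij}\oplus B_{ij}$ and $(A\otimes C)_{ij}=\bigoplus_k A_{ik}\otimes C_{kj}$, where infinite $\oplus$-sums are suprema in $\overline{\mathbb{R}}$. $\mathcal{E}$ is the matrix with all entries $-\infty$; $E$ is the max-plus identity ($0$ on the diagonal, $-\infty$ elsewhere). $\leq,\geq$ between matrices or vectors are entrywise. The Kleene star of a square matrix is $A^*=\bigoplus_{k=0}^{+\infty}A^k$, with $A^0=E$, $A^k=A^{k-1}\otimes A$. A semimodule is a subset of $\mathbb{R}_{\max}^n$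 closed under finitely many additions $\oplus$ and under multiplication by scalars in $\mathbb{R}_{\max}$. For $U\in\overline{\mathbb{R}}^{n\times p}$, $\operatorname{Im}U=\{U\otimes u\mid u\in\mathbb{R}_{\max}^p\}$. Controlled invariance: given $A\in\mathbb{R}_{\max}^{N\times N}$, $B\in\mathbb{R}_{\max}^{N\times m}$ (here $N,m$ denote dimensions), a semimodule $\mathcal{X}\subseteq\mathbb{R}_{\max}^N$ is $(A,B)$-invariant if for every initial vector in $\mathcal{X}$ there is a sequence of inputs in $\mathbb{R}_{\max}^m$ such that all subsequent states obtained through $x(k+1)=A\otimes x(k)\oplus B\otimes u(k)$ belong to $\mathcal{X}$. The maximal $(A,B)$-invariant subsemimodule of a semimodule $\mathcal{K}$ is the largest (with respect to inclusion) $(A,B)$-invariant semimodule contained in $\mathcal{K}$; it is the set of initial vectors for which there exists a sequence of inputs keeping the entire trajectory (including the initial vector) in $\mathcal{K}$. The map $\phi$ associated with $(\bar A,\bar B)$ is, for $\mathcal{X}\subseteq\mathbb{R}_{\max}^{2n}$, $\phi(\mathcal{X})=\mathcal{X}\cap\{x\in\mathbb{R}_{\max}^{2n}\mid(\exists u\in\mathbb{R}_{\max}^n)\ \bar{A}\otimes x\oplus\bar{B}\otimes u\in\mathcal{X}\}$. Its iterates are $\phi^0(\mathcal{X})=\mathcal{X}$ and $\phi^k(\mathcal{X})=\phi(\phi^{k-1}(\mathcal{X}))$ for $k\in\mathbb{N}$. Consistency: the system (P) is consistent if there exists an infinite trajectory $\{x(k)\}_{k\in\mathbb{N}}$ with $x(k)\in\mathbb{R}^n$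 satisfying all its inequalities. It is weakly consistent if for every $K\in\mathbb{N}$ there exists a finite trajectory $x(1),\dots,x(K)\in\mathbb{R}^n$ such that $x(k)\geq L\otimes x(k+1)$ and $x(k+1)\geq R\otimes x(k)$ for all $k\in\{1,\dots,K-1\}$, and $x(k)\geq C\otimes x(k)$ for all $k\in\{1,\dots,K\}$. *)

theory Defs
  imports "HOL-Analysis.Analysis"
begin

section \<open>Max-plus scalars, vectors and matrices\<close>

text \<open>
  Entries live in \<^typ>\<open>ereal\<close>. The max-plus semiring is the subset of elements different from
  plus infinity. Multiplication is not \<^typ>\<open>ereal\<close> addition, since the library has
  \<open>\<infinity> + (-\<infinity>) = \<infinity>\<close>, whereas minus infinity is absorbing here.
\<close>

definition otimes :: "ereal \<Rightarrow> ereal \<Rightarrow> ereal" (infixl "\<otimes>\<^sub>s" 70) where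
  "a \<otimes>\<^sub>s b = (if a = -\<infinity> \<or> b = -\<infinity> then -\<infinity> else a + b)"

definition rmax :: "ereal set" where
  "rmax = {a. a \<noteq> \<infinity>}"

definition rmax_vecs :: "(ereal^'n) set" where
  "rmax_vecs = {x. \<forall>i. x $ i \<in> rmax}"

definition rmax_mats :: "(ereal^'n^'m) set" where
  "rmax_mats = {A. \<forall>i j. A $ i $ j \<in> rmax}"

definition real_vecs :: "(ereal^'n) set" where
  "real_vecs = {x. \<forall>i. x $ i \<in> range ereal}"

definition vec_oplus :: "ereal^'n \<Rightarrow> ereal^'n \<Rightarrow> ereal^'n" (infixl "\<oplus>\<^sub>v" 65) where
  "x \<oplus>\<^sub>v y = (\<chi> i. max (x $ i) (y $ i))"

definition vec_scale :: "ereal \<Rightarrow> ereal^'n \<Rightarrow> ereal^'n" where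
  "vec_scale c x = (\<chi> i. c \<otimes>\<^sub>s x $ i)"

definition mat_vec :: "ereal^'n^'m \<Rightarrow> ereal^'n \<Rightarrow> ereal^'m" (infixr "\<otimes>\<^sub>v" 70) where
  "A \<otimes>\<^sub>v x = (\<chi> i. SUP j. A $ i $ j \<otimes>\<^sub>s x $ j)"

definition mat_mat :: "ereal^'k^'m \<Rightarrow> ereal^'n^'k \<Rightarrow> ereal^'n^'m" (infixl "\<otimes>\<^sub>m" 70) where
  "A \<otimes>\<^sub>m B = (\<chi> i j. SUP k. A $ i $ k \<otimes>\<^sub>s B $ k $ j)"

definition mp_zero :: "ereal^'n^'m" where
  "mp_zero = (\<chi> i j. -\<infinity>)"

definition mp_id :: "ereal^'n^'n" where
  "mp_id = (\<chi> i j. if i = j then 0 else -\<infinity>)"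

primrec mp_power :: "ereal^'n^'n \<Rightarrow> nat \<Rightarrow> ereal^'n^'n" where
  "mp_power A 0 = mp_id"
| "mp_power A (Suc k) = mp_power A k \<otimes>\<^sub>m A"

definition kleene_star :: "ereal^'n^'n \<Rightarrow> ereal^'n^'n" where
  "kleene_star A = (\<chi> i j. SUP k. mp_power A k $ i $ j)"

definition mp_image :: "ereal^'p^'n \<Rightarrow> (ereal^'n) set" where
  "mp_image U = {U \<otimes>\<^sub>v u | u. u \<in> rmax_vecs}"

text \<open>Vectors of length \<open>2n\<close> are indexed by the sum type \<^typ>\<open>'n + 'n\<close>.\<close>

definition block_mat ::
  "ereal^'n^'n \<Rightarrow> ereal^'n^'n \<Rightarrow> ereal^'n^'n \<Rightarrow> ereal^'n^'n \<Rightarrow> ereal^('n + 'n)^('n + 'n)" where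
  "block_mat P Q S T = (\<chi> i j.
     case i of
       Inl i' \<Rightarrow> (case j of Inl j' \<Rightarrow> P $ i' $ j' | Inr j' \<Rightarrow> Q $ i' $ j')
     | Inr i' \<Rightarrow> (case j of Inl j' \<Rightarrow> S $ i' $ j' | Inr j' \<Rightarrow> T $ i' $ j'))"

definition block_col :: "ereal^'n^'n \<Rightarrow> ereal^'n^'n \<Rightarrow> ereal^'n^('n + 'n)" where
  "block_col P Q = (\<chi> i j. case i of Inl i' \<Rightarrow> P $ i' $ j | Inr i' \<Rightarrow> Q $ i' $ j)"


section \<open>Controlled invariance\<close>

definition semimodule :: "(ereal^'n) set \<Rightarrow> bool" where
  "semimodule X \<longleftrightarrow> X \<subseteq> rmax_vecs \<and>
     (\<forall>x\<in>X. \<forall>y\<in>X. x \<oplus>\<^sub>v y \<in> X) \<and> (\<forall>c\<in>rmax. \<forall>x\<in>X. vec_scale c x \<in> X)"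

definition controlled_traj ::
  "ereal^'n^'n \<Rightarrow> ereal^'m^'n \<Rightarrow> (nat \<Rightarrow> ereal^'m) \<Rightarrow> (nat \<Rightarrow> ereal^'n) \<Rightarrow> bool" where
  "controlled_traj A B u x \<longleftrightarrow>
     (\<forall>k. u k \<in> rmax_vecs) \<and> (\<forall>k. x (Suc k) = A \<otimes>\<^sub>v x k \<oplus>\<^sub>v B \<otimes>\<^sub>v u k)"

definition invariant_semimodule ::
  "ereal^'n^'n \<Rightarrow> ereal^'m^'n \<Rightarrow> (ereal^'n) set \<Rightarrow> bool" where
  "invariant_semimodule A B X \<longleftrightarrow> semimodule X \<and>
     (\<forall>x0\<in>X. \<exists>u x. controlled_traj A B u x \<and> x 0 = x0 \<and> (\<forall>k. x k \<in> X))"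

definition max_invariant ::
  "ereal^'n^'n \<Rightarrow> ereal^'m^'n \<Rightarrow> (ereal^'n) set \<Rightarrow> (ereal^'n) set" where
  "max_invariant A B K = (GREATEST X. invariant_semimodule A B X \<and> X \<subseteq> K)"

definition phi ::
  "ereal^'n^'n \<Rightarrow> ereal^'m^'n \<Rightarrow> (ereal^'n) set \<Rightarrow> (ereal^'n) set" where
  "phi A B X = X \<inter> {x \<in> rmax_vecs. \<exists>u\<in>rmax_vecs. A \<otimes>\<^sub>v x \<oplus>\<^sub>v B \<otimes>\<^sub>v u \<in> X}"


section \<open>The system of inequalities and its associated control system\<close>

definition A_bar :: "ereal^('n::finite + 'n)^('n + 'n)" where
  "A_bar = block_mat mp_zero mp_id mp_zero mp_zero"

definition B_bar :: "ereal^'n^('n + 'n)" where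
  "B_bar = block_col mp_zero mp_id"

definition H_mat :: "ereal^'n^'n \<Rightarrow> ereal^'n^'n \<Rightarrow> ereal^'n^'n \<Rightarrow> ereal^('n + 'n)^('n + 'n)" where
  "H_mat L C R = block_mat C L R C"

definition K_mod :: "ereal^'n^'n \<Rightarrow> ereal^'n^'n \<Rightarrow> ereal^'n^'n \<Rightarrow> (ereal^('n + 'n)) set" where
  "K_mod L C R = {x \<in> rmax_vecs. x \<ge> H_mat L C R \<otimes>\<^sub>v x}"

text \<open>
  Trajectories are indexed from 1; the value at 0 of the functions below is irrelevant.
\<close>

definition consistent :: "ereal^'n^'n \<Rightarrow> ereal^'n^'n \<Rightarrow> ereal^'n^'n \<Rightarrow> bool" where
  "consistent L C R \<longleftrightarrow> (\<exists>x::nat \<Rightarrow> ereal^'n. \<forall>k\<ge>1.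
     x k \<in> real_vecs \<and>
     x k \<ge> L \<otimes>\<^sub>v x (k + 1) \<and> x k \<ge> C \<otimes>\<^sub>v x k \<and> x (k + 1) \<ge> R \<otimes>\<^sub>v x k)"

definition weakly_consistent :: "ereal^'n^'n \<Rightarrow> ereal^'n^'n \<Rightarrow> ereal^'n^'n \<Rightarrow> bool" where
  "weakly_consistent L C R \<longleftrightarrow> (\<forall>N\<ge>1. \<exists>x::nat \<Rightarrow> ereal^'n.
     (\<forall>k\<in>{1..N}. x k \<in> real_vecs \<and> x k \<ge> C \<otimes>\<^sub>v x k) \<and>
     (\<forall>k\<in>{1..<N}. x k \<ge> L \<otimes>\<^sub>v x (k + 1) \<and> x (k + 1) \<ge> R \<otimes>\<^sub>v x k))"


section \<open>Well-definedness of the maximal invariant subsemimodule\<close>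

lemma otimes_le_iff: "c \<noteq> \<infinity> \<Longrightarrow> a \<otimes>\<^sub>s c \<le> d \<longleftrightarrow> c = -\<infinity> \<or> a \<le> d - c"
  by (cases a; cases c; cases d) (auto simp: otimes_def)

lemma otimes_commute: "a \<otimes>\<^sub>s b = b \<otimes>\<^sub>s a"
  by (auto simp: otimes_def add.commute)

lemma otimes_assoc: "a \<otimes>\<^sub>s b \<otimes>\<^sub>s c = a \<otimes>\<^sub>s (b \<otimes>\<^sub>s c)"
  by (cases a; cases b; cases c) (auto simp: otimes_def)

lemma otimes_mono: "a \<le> a' \<Longrightarrow> b \<le> b' \<Longrightarrow> a \<otimes>\<^sub>s b \<le> a' \<otimes>\<^sub>s b'"
  by (auto simp: otimes_def intro: add_mono)

lemma otimes_rmax: "a \<in> rmax \<Longrightarrow> b \<in> rmax \<Longrightarrow> a \<otimes>\<^sub>s b \<in> rmax"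
  by (auto simp: otimes_def rmax_def)

lemma otimes_max: "a \<otimes>\<^sub>s max b c = max (a \<otimes>\<^sub>s b) (a \<otimes>\<^sub>s c)"
proof (cases "b \<le> c")
  case True
  then show ?thesis using otimes_mono[OF order_refl True] by (simp add: max_absorb2)
next
  case False
  then have "c \<le> b" by simp
  then show ?thesis using otimes_mono[OF order_refl \<open>c \<le> b\<close>] by (simp add: max_absorb1)
qed

lemma SUP_otimes_le_iff:
  fixes f :: "'i \<Rightarrow> ereal"
  assumes "c \<noteq> \<infinity>"
  shows "(SUP k. f k) \<otimes>\<^sub>s c \<le> d \<longleftrightarrow> (\<forall>k. f k \<otimes>\<^sub>s c \<le> d)"
  using assms by (auto simp: otimes_le_iff SUP_le_iff)

lemma SUP_otimes:
  fixes f :: "'i \<Rightarrow> ereal"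
  assumes "c \<noteq> \<infinity>"
  shows "c \<otimes>\<^sub>s (SUP k. f k) = (SUP k. c \<otimes>\<^sub>s f k)"
proof (rule antisym)
  show "c \<otimes>\<^sub>s (SUP k. f k) \<le> (SUP k. c \<otimes>\<^sub>s f k)"
    unfolding otimes_commute[of c] SUP_otimes_le_iff[OF assms] by (auto intro: SUP_upper)
  show "(SUP k. c \<otimes>\<^sub>s f k) \<le> c \<otimes>\<^sub>s (SUP k. f k)"
    by (intro SUP_least otimes_mono) (auto intro: SUP_upper)
qed

lemma mat_vec_oplus:
  fixes A :: "ereal^'n^'m"
  shows "A \<otimes>\<^sub>v (x \<oplus>\<^sub>v y) = A \<otimes>\<^sub>v x \<oplus>\<^sub>v A \<otimes>\<^sub>v y"
proof -
  have "(SUP j. max (f j) (g j)) = max (SUP j. f j) (SUP j. g j)" for f g :: "'n \<Rightarrow> ereal"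
    using complete_lattice_class.SUP_sup_distrib[of f UNIV g] by (simp only: sup_max)
  then show ?thesis by (simp add: mat_vec_def vec_oplus_def otimes_max)
qed

lemma otimes_left_commute: "a \<otimes>\<^sub>s (b \<otimes>\<^sub>s c) = b \<otimes>\<^sub>s (a \<otimes>\<^sub>s c)"
  unfolding otimes_assoc[symmetric] otimes_commute[of a b] ..

lemma mat_vec_scale:
  assumes "c \<in> rmax"
  shows "A \<otimes>\<^sub>v vec_scale c x = vec_scale c (A \<otimes>\<^sub>v x)"
proof -
  have c: "c \<noteq> \<infinity>" using assms by (simp add: rmax_def)
  show ?thesis by (simp add: mat_vec_def vec_scale_def SUP_otimes[OF c] otimes_left_commute[of c])
qed

lemma vec_scale_oplus: "vec_scale c (x \<oplus>\<^sub>v y) = vec_scale c x \<oplus>\<^sub>v vec_scale c y"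
  by (simp add: vec_scale_def vec_oplus_def otimes_max)

lemma rmax_vecs_oplus: "x \<in> rmax_vecs \<Longrightarrow> y \<in> rmax_vecs \<Longrightarrow> x \<oplus>\<^sub>v y \<in> rmax_vecs"
  by (auto simp: rmax_vecs_def vec_oplus_def max_def)

lemma rmax_vecs_scale: "c \<in> rmax \<Longrightarrow> x \<in> rmax_vecs \<Longrightarrow> vec_scale c x \<in> rmax_vecs"
  by (auto simp: rmax_vecs_def vec_scale_def otimes_rmax)

lemma max_invariant_eq:
  assumes "semimodule K"
  shows "max_invariant A B K =
    {x0. \<exists>u x. controlled_traj A B u x \<and> x 0 = x0 \<and> (\<forall>k. x k \<in> K)}" (is "_ = ?T")
    and "invariant_semimodule A B (max_invariant A B K)"
    and "max_invariant A B K \<subseteq> K"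
    and "invariant_semimodule A B X \<Longrightarrow> X \<subseteq> K \<Longrightarrow> X \<subseteq> max_invariant A B K"
proof -
  have sub: "?T \<subseteq> K" by auto
  have add: "x0 \<oplus>\<^sub>v y0 \<in> ?T" if T: "x0 \<in> ?T" "y0 \<in> ?T" for x0 y0
  proof -
    obtain u x where x: "controlled_traj A B u x" "x 0 = x0" "\<forall>k. x k \<in> K" using T by auto
    obtain v y where y: "controlled_traj A B v y" "y 0 = y0" "\<forall>k. y k \<in> K" using T by auto
    have "controlled_traj A B (\<lambda>k. u k \<oplus>\<^sub>v v k) (\<lambda>k. x k \<oplus>\<^sub>v y k)"
    proof -
      have "u k \<oplus>\<^sub>v v k \<in> rmax_vecs" for k
        using x(1) y(1) by (simp add: controlled_traj_def rmax_vecs_oplus)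
      moreover have "a \<oplus>\<^sub>v b \<oplus>\<^sub>v (c \<oplus>\<^sub>v d) = a \<oplus>\<^sub>v c \<oplus>\<^sub>v (b \<oplus>\<^sub>v d)" for a b c d :: "ereal^'a"
        by (simp add: vec_oplus_def ac_simps)
      ultimately show ?thesis
        using x(1) y(1) by (simp add: controlled_traj_def mat_vec_oplus)
    qed
    moreover have "\<forall>k. x k \<oplus>\<^sub>v y k \<in> K" using x y assms by (auto simp: semimodule_def)
    moreover have "x 0 \<oplus>\<^sub>v y 0 = x0 \<oplus>\<^sub>v y0" using x(2) y(2) by simp
    ultimately show ?thesis by blast
  qed
  have scl: "vec_scale c x0 \<in> ?T" if c: "c \<in> rmax" and T: "x0 \<in> ?T" for c x0
  proof -
    obtain u x where x: "controlled_traj A B u x" "x 0 = x0" "\<forall>k. x k \<in> K" using T by auto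
    have "controlled_traj A B (\<lambda>k. vec_scale c (u k)) (\<lambda>k. vec_scale c (x k))"
      using x(1) c
      by (simp add: controlled_traj_def rmax_vecs_scale mat_vec_scale vec_scale_oplus)
    moreover have "\<forall>k. vec_scale c (x k) \<in> K" using x assms c by (auto simp: semimodule_def)
    moreover have "vec_scale c (x 0) = vec_scale c x0" using x(2) by simp
    ultimately show ?thesis by blast
  qed
  have "semimodule ?T"
    using add scl sub assms unfolding semimodule_def by blast
  moreover have "\<exists>u x. controlled_traj A B u x \<and> x 0 = x0 \<and> (\<forall>k. x k \<in> ?T)"
    if T: "x0 \<in> ?T" for x0
  proof -
    obtain u x where x: "controlled_traj A B u x" "x 0 = x0" "\<forall>k. x k \<in> K" using T by auto
    have "x k \<in> ?T" for k
    proof -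
      have "controlled_traj A B (\<lambda>i. u (k + i)) (\<lambda>i. x (k + i))"
        using x(1) by (simp add: controlled_traj_def)
      moreover have "x (k + 0) = x k" "\<forall>i. x (k + i) \<in> K" using x(3) by auto
      ultimately show ?thesis by blast
    qed
    then show ?thesis using x by blast
  qed
  ultimately have inv: "invariant_semimodule A B ?T"
    unfolding invariant_semimodule_def by blast
  have max: "X \<subseteq> ?T" if "invariant_semimodule A B X" "X \<subseteq> K" for X
    using that unfolding invariant_semimodule_def by blast
  show eq: "max_invariant A B K = ?T"
    unfolding max_invariant_def by (rule Greatest_equality) (use inv sub max in auto)
  show "invariant_semimodule A B (max_invariant A B K)" "max_invariant A B K \<subseteq> K"
    unfolding eq using inv sub by auto
  show "invariant_semimodule A B X \<Longrightarrow> X \<subseteq> K \<Longrightarrow> X \<subseteq> max_invariant A B K"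
    unfolding eq by (rule max)
qed


section \<open>The inequality set as the image of a Kleene star\<close>

text \<open>
  The intersection with \<^const>\<open>rmax_vecs\<close> matters only if the star has entries equal to
  plus infinity; its image then also contains vectors outside the semiring.
\<close>

lemma mat_vec_le_iff:
  "A \<otimes>\<^sub>v x \<le> y \<longleftrightarrow> (\<forall>i j. A $ i $ j \<otimes>\<^sub>s x $ j \<le> y $ i)"
  by (simp add: mat_vec_def less_eq_vec_def SUP_le_iff)

lemma mp_power_subinvariant:
  assumes "x \<in> rmax_vecs" "A \<otimes>\<^sub>v x \<le> x"
  shows "mp_power A k \<otimes>\<^sub>v x \<le> x"
proof (induction k)
  case 0
  show ?case by (simp add: mat_vec_le_iff mp_id_def otimes_def)
next
  case (Suc k)
  have "mp_power A (Suc k) $ i $ j \<otimes>\<^sub>s x $ j \<le> x $ i" for i j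
  proof -
    have "mp_power A k $ i $ l \<otimes>\<^sub>s A $ l $ j \<otimes>\<^sub>s x $ j \<le> x $ i" for l
    proof -
      have "mp_power A k $ i $ l \<otimes>\<^sub>s (A $ l $ j \<otimes>\<^sub>s x $ j) \<le> mp_power A k $ i $ l \<otimes>\<^sub>s x $ l"
        using assms(2) by (intro otimes_mono) (auto simp: mat_vec_le_iff)
      also have "\<dots> \<le> x $ i" using Suc by (simp add: mat_vec_le_iff)
      finally show ?thesis by (simp add: otimes_assoc)
    qed
    then show ?thesis
      using assms(1) by (simp add: mat_mat_def SUP_otimes_le_iff rmax_vecs_def rmax_def)
  qed
  then show ?case by (simp add: mat_vec_le_iff)
qed

lemma mat_mp_power_le:
  assumes "A \<in> rmax_mats"
  shows "A $ i $ j \<otimes>\<^sub>s mp_power A m $ j $ k \<le> mp_power A (Suc m) $ i $ k"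
proof (induction m arbitrary: k)
  case 0
  have "mp_id $ i $ i \<otimes>\<^sub>s A $ i $ k \<le> (mp_id \<otimes>\<^sub>m A) $ i $ k"
    unfolding mat_mat_def by (auto intro: SUP_upper2)
  then show ?case by (auto simp: mp_id_def otimes_def)
next
  case (Suc m)
  have A: "A $ i $ j \<noteq> \<infinity>" using assms by (simp add: rmax_mats_def rmax_def)
  have "A $ i $ j \<otimes>\<^sub>s (mp_power A m $ j $ l \<otimes>\<^sub>s A $ l $ k) \<le> mp_power A (Suc (Suc m)) $ i $ k" for l
  proof -
    have "A $ i $ j \<otimes>\<^sub>s mp_power A m $ j $ l \<otimes>\<^sub>s A $ l $ k \<le> mp_power A (Suc m) $ i $ l \<otimes>\<^sub>s A $ l $ k"
      by (intro otimes_mono Suc order_refl)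
    also have "\<dots> \<le> mp_power A (Suc (Suc m)) $ i $ k"
      by (simp only: mp_power.simps(2)[of A "Suc m"] mat_mat_def vec_lambda_beta)
        (rule SUP_upper, simp)
    finally show ?thesis by (simp add: otimes_assoc)
  qed
  then show ?case
    by (simp add: mat_mat_def[of "mp_power A m"] SUP_otimes[OF A] SUP_le_iff del: mp_power.simps(2)
        add: mp_power.simps(2)[of A m])
qed

lemma subinvariant_eq_image_star:
  assumes "A \<in> rmax_mats"
  shows "{x \<in> rmax_vecs. x \<ge> A \<otimes>\<^sub>v x} = mp_image (kleene_star A) \<inter> rmax_vecs"
proof (intro equalityI subsetI)
  fix x assume "x \<in> {x \<in> rmax_vecs. x \<ge> A \<otimes>\<^sub>v x}"
  then have x: "x \<in> rmax_vecs" "A \<otimes>\<^sub>v x \<le> x" by auto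
  have "kleene_star A \<otimes>\<^sub>v x \<le> x"
    using mp_power_subinvariant[OF x] x(1)
    by (simp add: mat_vec_le_iff kleene_star_def SUP_otimes_le_iff rmax_vecs_def rmax_def)
  moreover have "x \<le> kleene_star A \<otimes>\<^sub>v x"
    unfolding less_eq_vec_def
  proof
    fix i
    have "x $ i = mp_power A 0 $ i $ i \<otimes>\<^sub>s x $ i" by (simp add: mp_id_def otimes_def)
    also have "\<dots> \<le> kleene_star A $ i $ i \<otimes>\<^sub>s x $ i"
      unfolding kleene_star_def vec_lambda_beta by (intro otimes_mono SUP_upper) auto
    also have "\<dots> \<le> (kleene_star A \<otimes>\<^sub>v x) $ i"
      unfolding mat_vec_def vec_lambda_beta by (rule SUP_upper) auto
    finally show "x $ i \<le> (kleene_star A \<otimes>\<^sub>v x) $ i" .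
  qed
  ultimately have "x = kleene_star A \<otimes>\<^sub>v x" by (rule antisym[rotated])
  then show "x \<in> mp_image (kleene_star A) \<inter> rmax_vecs"
    using x(1) by (auto simp: mp_image_def)
next
  fix y assume "y \<in> mp_image (kleene_star A) \<inter> rmax_vecs"
  then obtain u where y: "y \<in> rmax_vecs" "y = kleene_star A \<otimes>\<^sub>v u" and u: "u \<in> rmax_vecs"
    by (auto simp: mp_image_def)
  have "A $ i $ j \<otimes>\<^sub>s y $ j \<le> y $ i" for i j
  proof -
    have A: "A $ i $ j \<noteq> \<infinity>" using assms by (simp add: rmax_mats_def rmax_def)
    have uk: "u $ k \<noteq> \<infinity>" for k using u by (simp add: rmax_vecs_def rmax_def)
    have "A $ i $ j \<otimes>\<^sub>s (kleene_star A $ j $ k \<otimes>\<^sub>s u $ k) \<le> y $ i" for k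
    proof -
      have "A $ i $ j \<otimes>\<^sub>s mp_power A m $ j $ k \<otimes>\<^sub>s u $ k \<le> y $ i" for m
      proof -
        have "mp_power A (Suc m) $ i $ k \<le> kleene_star A $ i $ k"
          unfolding kleene_star_def vec_lambda_beta by (rule SUP_upper) simp
        then have "A $ i $ j \<otimes>\<^sub>s mp_power A m $ j $ k \<le> kleene_star A $ i $ k"
          using mat_mp_power_le[OF assms] order_trans by blast
        then have "A $ i $ j \<otimes>\<^sub>s mp_power A m $ j $ k \<otimes>\<^sub>s u $ k \<le> kleene_star A $ i $ k \<otimes>\<^sub>s u $ k"
          by (intro otimes_mono) auto
        also have "\<dots> \<le> y $ i"
          unfolding y(2) mat_vec_def vec_lambda_beta by (rule SUP_upper) simp
        finally show ?thesis .
      qed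
      then have "A $ i $ j \<otimes>\<^sub>s kleene_star A $ j $ k \<otimes>\<^sub>s u $ k \<le> y $ i"
        by (simp add: kleene_star_def SUP_otimes[OF A] SUP_otimes_le_iff[OF uk])
      then show ?thesis by (simp add: otimes_assoc)
    qed
    then show ?thesis
      by (subst y(2)) (simp add: mat_vec_def SUP_otimes[OF A] SUP_le_iff)
  qed
  then show "y \<in> {x \<in> rmax_vecs. x \<ge> A \<otimes>\<^sub>v x}"
    using y(1) by (simp add: mat_vec_le_iff)
qed

lemma K_mod_eq_image_star:
  assumes "L \<in> rmax_mats" "C \<in> rmax_mats" "R \<in> rmax_mats"
  shows "K_mod L C R = mp_image (kleene_star (H_mat L C R)) \<inter> rmax_vecs"
proof -
  have "H_mat L C R \<in> rmax_mats"
    using assms by (auto simp: rmax_mats_def H_mat_def block_mat_def split: sum.split)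
  then show ?thesis unfolding K_mod_def by (rule subinvariant_eq_image_star)
qed

lemma semimodule_K_mod: "semimodule (K_mod L C R)"
proof -
  have 1: "vec_scale c x \<le> vec_scale c y" if "x \<le> y" for c and x y :: "ereal^'i"
    using that by (auto simp: less_eq_vec_def vec_scale_def otimes_mono)
  have 2: "x \<oplus>\<^sub>v y \<le> x' \<oplus>\<^sub>v y'" if "x \<le> x'" "y \<le> y'" for x y x' y' :: "ereal^'i"
    using that unfolding less_eq_vec_def vec_oplus_def vec_lambda_beta
    by (intro allI max.mono) auto
  show ?thesis
    by (auto simp: semimodule_def K_mod_def rmax_vecs_oplus rmax_vecs_scale mat_vec_oplus
        mat_vec_scale intro: 1 2)
qed

end

theory Submission
  imports Defs
begin

text \<open>
  The system is an inequality system on an infinite directed graph whose nodes are pairs of a level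
  \<open>m\<close> and an index \<open>i\<close>: finite entries of \<open>C\<close> are arcs inside a level, those of \<open>R\<close> lead one level
  up, those of \<open>L\<close> one level down, and a trajectory is a potential on this graph. Since the graph
  looks the same from every level, all constraints that a long trajectory imposes on its first state
  \<open>b\<close> alone come from \<^emph>\<open>excursions\<close>, the paths that start and end in the bottom level:
  \<open>b\<close> must satisfy \<open>w + b\<^sub>j \<le> b\<^sub>i\<close> for every excursion of weight \<open>w\<close> from \<open>j\<close> to
  \<open>i\<close> whose height is at most the number of transitions (\<open>stable\<close>).

  Stability is also sufficient if \<open>b\<close> is real or the weights of excursions are bounded
  (\<open>stable_imp_trajectory\<close>, \<open>stable_imp_infinite_trajectory\<close>): the next
  state may be taken as the supremum over all excursions of what the current state forces, and, if
  the current state is real, this can be done without using the value minus infinity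
  (\<open>next_level\<close>). Hence consistency means that some real vector is stable at all heights, weak
  consistency that every height has a real stable vector. Likewise, the maximal invariant semimodule
  contains a real vector if and only if some real vector is stable at all heights, and \<open>\<phi>\<^sup>k(K)\<close>
  does if and only if some real vector is stable at height \<open>k + 1\<close>. A real vector
  that lies in all \<open>\<phi>\<^sup>k(K)\<close> has a first half that is stable at all heights. So if the real
  parts are eventually constant and nonempty, the system is consistent. This settles
  everything except the number of steps in the consistent case.

  The bound \<open>n\<^sup>2 - 1\<close> for that number is a pumping argument. In a consistent system the weights of
  excursions are bounded. An excursion that climbs to height \<open>n\<^sup>2\<close> or more crosses each of
  \<open>n\<^sup>2 + 1\<close> levels once upwards and once downwards around its summit, and two of these
  levels have the same pair of crossing indices. If the part between these two levels has positive
  weight, repeating it yields unbounded weights; otherwise, cutting it out yields a shorter excursion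
  of at least the same weight (\<open>excursion_height_reduce\<close>). Thus stability at height
  \<open>n\<^sup>2 - 1\<close> implies stability at all heights, even for vectors with entries minus infinity.
\<close>

section \<open>Inequalities over the finite entries\<close>

text \<open>
  Entries minus infinity impose nothing, so a matrix inequality is a family of inequalities with real
  weights; these are the arcs of the level graph.
\<close>

lemma mat_vec_le_iff_finite:
  assumes "A \<in> rmax_mats"
  shows "A \<otimes>\<^sub>v x \<le> y \<longleftrightarrow> (\<forall>i j r. A $ i $ j = ereal r \<longrightarrow> ereal r + x $ j \<le> y $ i)"
proof -
  have "A $ i $ j \<otimes>\<^sub>s x $ j \<le> y $ i \<longleftrightarrow> (\<forall>r. A $ i $ j = ereal r \<longrightarrow> ereal r + x $ j \<le> y $ i)" for i j
    using assms by (cases "A $ i $ j"; cases "x $ j") (auto simp: otimes_def rmax_mats_def rmax_def)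
  then show ?thesis by (simp add: mat_vec_le_iff)
qed

lemma real_imp_rmax_vecs: "x \<in> real_vecs \<Longrightarrow> x \<in> rmax_vecs"
  by (force simp: real_vecs_def rmax_vecs_def rmax_def)

lemma finite_family_bounded_above:
  fixes f :: "'a::finite \<Rightarrow> ereal"
  assumes "\<And>a. f a \<noteq> \<infinity>"
  obtains G where "\<And>a. f a \<le> ereal G"
proof
  fix a
  have "f a \<le> ereal (real_of_ereal (f a))" using assms[of a] by (cases "f a") auto
  also have "\<dots> \<le> ereal (Max (range (\<lambda>a. real_of_ereal (f a))))" by simp
  finally show "f a \<le> ereal (Max (range (\<lambda>a. real_of_ereal (f a))))" .
qed

lemma real_vec_bounded:
  assumes "b \<in> real_vecs"
  obtains M where "\<And>i. b $ i \<le> ereal M" "\<And>i. ereal (- M) \<le> b $ i"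
proof -
  have fin: "\<bar>b $ i\<bar> \<noteq> \<infinity>" for i using assms by (force simp: real_vecs_def)
  then obtain M where M: "\<And>i. \<bar>b $ i\<bar> \<le> ereal M"
    using finite_family_bounded_above[of "\<lambda>i. \<bar>b $ i\<bar>"] by blast
  have "b $ i \<le> ereal M \<and> ereal (- M) \<le> b $ i" for i
    using M[of i] by (cases "b $ i") auto
  then show ?thesis using that by blast
qed


section \<open>Excursions in the level graph\<close>

locale max_plus_system =
  fixes L C R :: "ereal^'n^'n"
  assumes L: "L \<in> rmax_mats" and C: "C \<in> rmax_mats" and R: "R \<in> rmax_mats"
begin

text \<open>
  In \<open>excursion s h j i w\<close> the path runs from \<open>j\<close> to \<open>i\<close>, has weight \<open>w\<close> and never rises more than
  \<open>h\<close> levels above its end points; \<open>s\<close> counts the rule applications and is the induction measure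
  of the pumping argument. The inner excursion of a hill is based one level higher, where only
  \<open>h\<close> of the allowed \<open>Suc h\<close> levels are left.
\<close>

inductive excursion :: "nat \<Rightarrow> nat \<Rightarrow> 'n \<Rightarrow> 'n \<Rightarrow> real \<Rightarrow> bool" where
  stay: "excursion 0 h i i 0"
| level: "excursion s h j l w \<Longrightarrow> C $ i $ l = ereal c \<Longrightarrow> excursion (Suc s) h j i (w + c)"
| hill: "excursion s (Suc h) j l w \<Longrightarrow> R $ p $ l = ereal r \<Longrightarrow> excursion t h p q v \<Longrightarrow>
    L $ i $ q = ereal d \<Longrightarrow> excursion (Suc (s + t)) (Suc h) j i (w + (r + v + d))"

lemma excursion_mono: "excursion s h j i w \<Longrightarrow> h \<le> h' \<Longrightarrow> excursion s h' j i w"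
proof (induction arbitrary: h' rule: excursion.induct)
  case (hill s h j l w p r t q v i d)
  then obtain h'' where "h' = Suc h''" "h \<le> h''" by (cases h') auto
  with hill show ?case by (auto intro: excursion.hill)
qed (auto intro: excursion.intros)

lemma excursion_trans:
  assumes "excursion t h l i v" "excursion s h j l w"
  shows "excursion (s + t) h j i (w + v)"
  using assms
proof (induction rule: excursion.induct)
  case (stay h i)
  then show ?case by simp
next
  case (level t h l k v i c)
  then show ?case using excursion.level[of "s + t" h j k "w + v" i c] by (simp add: add.assoc)
next
  case (hill t h l k v p r t' q v' i d)
  then show ?case
    using excursion.hill[of "s + t" h j k "w + v" p r t' q v' i d] by (simp add: add.assoc)
qed

definition stable :: "nat \<Rightarrow> ereal^'n \<Rightarrow> bool" where
  "stable h b \<longleftrightarrow> (\<forall>s j i w. excursion s h j i w \<longrightarrow> ereal w + b $ j \<le> b $ i)"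

definition bounded_excursions :: bool where
  "bounded_excursions \<longleftrightarrow> (\<exists>B. \<forall>s h j i w. excursion s h j i w \<longrightarrow> w \<le> B)"

text \<open>
  The states of index \<open>0\<close> to \<open>N\<close> are constrained, so there are \<open>N\<close> transitions. Entries may be
  minus infinity, as in the semimodules; real trajectories are singled out separately.
\<close>

definition trajectory :: "nat \<Rightarrow> (nat \<Rightarrow> ereal^'n) \<Rightarrow> bool" where
  "trajectory N x \<longleftrightarrow> (\<forall>m\<le>N. x m \<in> rmax_vecs \<and> C \<otimes>\<^sub>v x m \<le> x m) \<and>
     (\<forall>m<N. L \<otimes>\<^sub>v x (Suc m) \<le> x m \<and> R \<otimes>\<^sub>v x m \<le> x (Suc m))"

lemma stable_antimono: "stable h' b \<Longrightarrow> h \<le> h' \<Longrightarrow> stable h b"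
  unfolding stable_def using excursion_mono by blast

text \<open>
  Summing the inequalities of a trajectory along a path. The excursion may be based at any level
  \<open>m\<close> from which its height still fits below level \<open>N\<close>.
\<close>

lemma excursion_le_trajectory:
  assumes "trajectory N x" "excursion s h j i w" "m + h \<le> N"
  shows "ereal w + x m $ j \<le> x m $ i"
  using assms(2,3)
proof (induction arbitrary: m rule: excursion.induct)
  case (stay h i)
  then show ?case by (simp add: zero_ereal_def[symmetric])
next
  case (level s h j l w i c)
  have "C \<otimes>\<^sub>v x m \<le> x m" using assms(1) level.prems by (simp add: trajectory_def)
  then have "ereal c + x m $ l \<le> x m $ i"
    using level.hyps(2) by (simp add: mat_vec_le_iff_finite[OF C])
  moreover have "ereal c + (ereal w + x m $ j) \<le> ereal c + x m $ l"
    using level by (intro add_left_mono) auto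
  ultimately show ?case
    by (metis add.assoc add.commute order_trans plus_ereal.simps(1))
next
  case (hill s h j l w p r t q v i d)
  have "L \<otimes>\<^sub>v x (Suc m) \<le> x m" "R \<otimes>\<^sub>v x m \<le> x (Suc m)"
    using assms(1) hill.prems by (simp_all add: trajectory_def)
  then have d: "ereal d + x (Suc m) $ q \<le> x m $ i" and r: "ereal r + x m $ l \<le> x (Suc m) $ p"
    using hill.hyps by (simp_all add: mat_vec_le_iff_finite[OF L] mat_vec_le_iff_finite[OF R])
  have v: "ereal v + x (Suc m) $ p \<le> x (Suc m) $ q" using hill.IH(2) hill.prems by simp
  have "ereal (w + (r + v + d)) + x m $ j = ereal d + (ereal v + (ereal r + (ereal w + x m $ j)))"
    by (cases "x m $ j") auto
  also have "\<dots> \<le> ereal d + (ereal v + (ereal r + x m $ l))"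
    using hill.IH(1) hill.prems by (intro add_left_mono) auto
  also have "\<dots> \<le> ereal d + (ereal v + x (Suc m) $ p)" by (intro add_left_mono r)
  also have "\<dots> \<le> ereal d + x (Suc m) $ q" by (intro add_left_mono v)
  also have "\<dots> \<le> x m $ i" by (rule d)
  finally show ?case .
qed

lemma trajectory_stable:
  assumes "trajectory N x" "m + h \<le> N"
  shows "stable h (x m)"
  using excursion_le_trajectory[OF assms(1) _ assms(2)] by (auto simp: stable_def)

lemma stable_imp_C_le:
  assumes "stable h b"
  shows "C \<otimes>\<^sub>v b \<le> b"
proof -
  have "ereal c + b $ l \<le> b $ i" if "C $ i $ l = ereal c" for i l c
    using assms excursion.level[OF excursion.stay that, of h] by (auto simp: stable_def)
  then show ?thesis by (simp add: mat_vec_le_iff_finite[OF C])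
qed

lemma stable_hill:
  assumes "stable (Suc h) b" "R $ p $ l = ereal r" "excursion t h p q v" "L $ i $ q = ereal d"
  shows "ereal (r + v + d) + b $ l \<le> b $ i"
  using assms(1) excursion.hill[OF excursion.stay assms(2-4)] by (auto simp: stable_def)

text \<open>
  A real vector bounds the weights by its own differences, so one bound serves all heights at which it
  is stable.
\<close>

lemma stable_real_bounded:
  assumes "b \<in> real_vecs"
  obtains B where "\<And>s h j i w. stable h b \<Longrightarrow> excursion s h j i w \<Longrightarrow> w \<le> B"
proof -
  obtain M where M: "\<And>i. b $ i \<le> ereal M" "\<And>i. ereal (- M) \<le> b $ i"
    using real_vec_bounded[OF assms] by blast
  have "w \<le> 2 * M" if "stable h b" "excursion s h j i w" for s h j i w
  proof -
    have "ereal (w - M) \<le> ereal w + b $ j" using M(2)[of j] by (cases "b $ j") auto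
    also have "\<dots> \<le> b $ i" using that by (auto simp: stable_def)
    also have "\<dots> \<le> ereal M" by (rule M)
    finally show ?thesis by simp
  qed
  then show ?thesis using that by blast
qed


section \<open>Building trajectories level by level\<close>

text \<open>
  The relation \<open>E\<close> stands for the excursions that the rest of the trajectory still has to respect:
  those of some height \<open>h\<close> for a finite trajectory, all of them for an infinite one. The hill
  hypothesis says that climbing from \<open>b\<close>, making such an excursion and descending again does not
  violate \<open>b\<close>. The least vector above \<open>R \<otimes> b\<close> that respects \<open>E\<close> is then a possible next state,
  but it may have entries minus infinity. If \<open>b\<close> is real, every entry of \<open>R \<otimes> b\<close> is first
  raised to a real floor \<open>e\<close>, chosen so low that \<open>E\<close> followed by \<open>L\<close> cannot carry it above
  \<open>b\<close>; boundedness of \<open>E\<close> makes this possible.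
\<close>

lemma next_level:
  fixes E :: "'n \<Rightarrow> 'n \<Rightarrow> real \<Rightarrow> bool"
  assumes refl: "\<And>i. E i i 0"
    and trans: "\<And>j l i w v. E j l w \<Longrightarrow> E l i v \<Longrightarrow> E j i (w + v)"
    and bound: "\<And>j i w. E j i w \<Longrightarrow> w \<le> B"
    and b: "b \<in> rmax_vecs"
    and hill: "\<And>p l r q v i d. R $ p $ l = ereal r \<Longrightarrow> E p q v \<Longrightarrow> L $ i $ q = ereal d \<Longrightarrow>
      ereal (r + v + d) + b $ l \<le> b $ i"
  obtains c where "c \<in> rmax_vecs" "b \<in> real_vecs \<Longrightarrow> c \<in> real_vecs"
    "\<And>j i w. E j i w \<Longrightarrow> ereal w + c $ j \<le> c $ i" "R \<otimes>\<^sub>v b \<le> c" "L \<otimes>\<^sub>v c \<le> b"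
proof -
  obtain e where e_top: "e \<noteq> \<infinity>" and e_real: "b \<in> real_vecs \<Longrightarrow> \<bar>e\<bar> \<noteq> \<infinity>"
    and e_le: "\<And>i q d j v. L $ i $ q = ereal d \<Longrightarrow> E j q v \<Longrightarrow> ereal (d + v) + e \<le> b $ i"
  proof (cases "b \<in> real_vecs")
    case True
    then obtain M where M: "\<And>i. ereal (- M) \<le> b $ i" using real_vec_bounded by blast
    obtain G where G: "\<And>a. (case a of (i, q) \<Rightarrow> L $ i $ q) \<le> ereal G"
      using finite_family_bounded_above[of "\<lambda>(i, q). L $ i $ q"] L
      by (force simp: rmax_mats_def rmax_def)
    have "ereal (d + v) + ereal (- (M + G + B)) \<le> b $ i" if "L $ i $ q = ereal d" "E j q v" for i q d j v
    proof -
      have "d \<le> G" using G[of "(i, q)"] that by simp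
      then have "ereal (d + v) + ereal (- (M + G + B)) \<le> ereal (- M)" using bound[OF that(2)] by simp
      then show ?thesis using M order_trans by blast
    qed
    then show ?thesis using that[of "ereal (- (M + G + B))"] by auto
  next
    case False
    then show ?thesis using that[of "- \<infinity>"] by auto
  qed
  \<comment> \<open>The values forced at the new level before excursions are taken into account.\<close>
  define g where "g j = max ((R \<otimes>\<^sub>v b) $ j) e" for j
  \<comment> \<open>Over a finite index type the supremum is attained, hence comes from a single arc.\<close>
  have Rb: "(R \<otimes>\<^sub>v b) $ j = Max (range (\<lambda>l. R $ j $ l \<otimes>\<^sub>s b $ l))" for j
    by (simp add: mat_vec_def Max_Sup)
  have Rb_top: "(R \<otimes>\<^sub>v b) $ j \<noteq> \<infinity>" for j
  proof -
    have "(R \<otimes>\<^sub>v b) $ j \<in> range (\<lambda>l. R $ j $ l \<otimes>\<^sub>s b $ l)" unfolding Rb by (rule Max_in) auto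
    moreover have "R $ j $ l \<otimes>\<^sub>s b $ l \<in> rmax" for l
      using R b by (intro otimes_rmax) (auto simp: rmax_mats_def rmax_vecs_def)
    ultimately have "(R \<otimes>\<^sub>v b) $ j \<in> rmax" by auto
    then show ?thesis by (simp add: rmax_def)
  qed
  have g_top: "g j \<noteq> \<infinity>" for j using Rb_top[of j] e_top by (simp add: g_def max_def)
  then obtain G where G: "\<And>j. g j \<le> ereal G" using finite_family_bounded_above[of g] by blast
  have Lg: "ereal (d + v) + g p \<le> b $ i" if "L $ i $ q = ereal d" "E p q v" for i q d p v
  proof -
    have "ereal (d + v) + (R \<otimes>\<^sub>v b) $ p \<le> b $ i"
    proof -
      have "(R \<otimes>\<^sub>v b) $ p \<in> range (\<lambda>l. R $ p $ l \<otimes>\<^sub>s b $ l)" unfolding Rb by (rule Max_in) auto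
      then obtain l where l: "(R \<otimes>\<^sub>v b) $ p = R $ p $ l \<otimes>\<^sub>s b $ l" by auto
      show ?thesis
      proof (cases "R $ p $ l")
        case (real r)
        have "ereal (d + v) + (R \<otimes>\<^sub>v b) $ p = ereal (r + v + d) + b $ l"
          unfolding l real by (cases "b $ l") (auto simp: otimes_def)
        then show ?thesis using hill[OF real that(2,1)] by simp
      next
        case PInf
        then show ?thesis using R by (simp add: rmax_mats_def rmax_def)
      next
        case MInf
        then show ?thesis by (simp add: l otimes_def)
      qed
    qed
    then show ?thesis using e_le[OF that] by (simp add: g_def max_def)
  qed
  define c where "c = (\<chi> i. SUP (j, w)\<in>{(j, w). E j i w}. ereal w + g j)"
  have c_upper: "ereal w + g j \<le> c $ i" if "E j i w" for j i w
    unfolding c_def vec_lambda_beta by (rule SUP_upper2[of "(j, w)"]) (use that in auto)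
  have c_least: "c $ i \<le> z" if "\<And>j w. E j i w \<Longrightarrow> ereal w + g j \<le> z" for i z
    unfolding c_def vec_lambda_beta by (rule SUP_least) (use that in auto)
  have g_le_c: "g j \<le> c $ j" for j using c_upper[OF refl, of j] by (simp add: zero_ereal_def[symmetric])
  have c_top: "c $ i \<noteq> \<infinity>" for i
  proof -
    have "c $ i \<le> ereal (B + G)"
    proof (rule c_least)
      fix j w assume "E j i w"
      then have "ereal w + g j \<le> ereal B + ereal G" by (intro add_mono G) (simp add: bound)
      then show "ereal w + g j \<le> ereal (B + G)" by simp
    qed
    then show ?thesis by auto
  qed
  show ?thesis
  proof
    show "c \<in> rmax_vecs" using c_top by (simp add: rmax_vecs_def rmax_def)
    show "c \<in> real_vecs" if "b \<in> real_vecs"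
    proof -
      have "c $ i \<in> range ereal" for i
      proof -
        have "e \<le> c $ i" using g_le_c[of i] by (simp add: g_def)
        then show ?thesis using e_real[OF that] c_top[of i] by (cases "c $ i") auto
      qed
      then show ?thesis by (simp add: real_vecs_def)
    qed
    show "ereal w + c $ j \<le> c $ i" if "E j i w" for j i w
    proof -
      have "c $ j \<le> c $ i - ereal w"
      proof (rule c_least)
        fix k v assume "E k j v"
        then have "ereal (v + w) + g k \<le> c $ i" using trans that by (intro c_upper) blast
        then show "ereal v + g k \<le> c $ i - ereal w" by (cases "g k"; cases "c $ i") auto
      qed
      then show ?thesis by (cases "c $ i"; cases "c $ j") auto
    qed
    show "R \<otimes>\<^sub>v b \<le> c"
      unfolding less_eq_vec_def using g_le_c by (auto simp: g_def)
    show "L \<otimes>\<^sub>v c \<le> b"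
    proof -
      have "ereal d + c $ q \<le> b $ i" if "L $ i $ q = ereal d" for i q d
      proof -
        have "c $ q \<le> b $ i - ereal d"
        proof (rule c_least)
          fix k v assume "E k q v"
          then have "ereal (d + v) + g k \<le> b $ i" using Lg that by blast
          then show "ereal v + g k \<le> b $ i - ereal d" by (cases "g k"; cases "b $ i") auto
        qed
        then show ?thesis by (cases "c $ q"; cases "b $ i") auto
      qed
      then show ?thesis by (simp add: mat_vec_le_iff_finite[OF L])
    qed
  qed
qed

lemma trajectory_Cons:
  assumes "trajectory N y" "b \<in> rmax_vecs" "C \<otimes>\<^sub>v b \<le> b" "L \<otimes>\<^sub>v y 0 \<le> b" "R \<otimes>\<^sub>v b \<le> y 0"
  shows "trajectory (Suc N) (case_nat b y)"
  using assms by (auto simp: trajectory_def split: nat.split)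

lemma trajectory_tl: "trajectory (Suc N) x \<Longrightarrow> trajectory N (\<lambda>m. x (Suc m))"
  by (auto simp: trajectory_def)

lemma trajectory_antimono: "trajectory N x \<Longrightarrow> M \<le> N \<Longrightarrow> trajectory M x"
  by (auto simp: trajectory_def)

text \<open>
  After one step a budget of \<open>Suc h\<close> levels becomes a budget of \<open>h\<close>. The disjunction supplies the
  bound on weights needed by \<open>next_level\<close>: a real state provides it by itself, other states rely on a
  global one.
\<close>

lemma stable_imp_trajectory:
  assumes "stable h b" "b \<in> rmax_vecs" "b \<in> real_vecs \<or> bounded_excursions"
  shows "\<exists>x. x 0 = b \<and> trajectory h x \<and> (b \<in> real_vecs \<longrightarrow> (\<forall>m\<le>h. x m \<in> real_vecs))"
  using assms
proof (induction h arbitrary: b)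
  case 0
  then have "trajectory 0 (\<lambda>_. b)" using stable_imp_C_le by (simp add: trajectory_def)
  then show ?case by (intro exI[of _ "\<lambda>_. b"]) simp
next
  case (Suc h)
  define E where "E j i w \<longleftrightarrow> (\<exists>s. excursion s h j i w)" for j i w
  obtain B where B: "\<And>j i w. E j i w \<Longrightarrow> w \<le> B"
  proof (cases "b \<in> real_vecs")
    case True
    have "stable h b" using Suc.prems(1) by (rule stable_antimono) simp
    then show ?thesis using stable_real_bounded[OF True] that unfolding E_def by metis
  next
    case False
    then show ?thesis using Suc.prems(3) that unfolding bounded_excursions_def E_def by metis
  qed
  obtain c where c: "c \<in> rmax_vecs" "b \<in> real_vecs \<Longrightarrow> c \<in> real_vecs"
    "\<And>j i w. E j i w \<Longrightarrow> ereal w + c $ j \<le> c $ i" "R \<otimes>\<^sub>v b \<le> c" "L \<otimes>\<^sub>v c \<le> b"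
  proof (rule next_level[of E B b])
    show "E i i 0" for i unfolding E_def using excursion.stay by blast
    show "E j i (w + v)" if "E j l w" "E l i v" for j l i w v
      using that excursion_trans unfolding E_def by blast
    show "ereal (r + v + d) + b $ l \<le> b $ i"
      if "R $ p $ l = ereal r" "E p q v" "L $ i $ q = ereal d" for p l r q v i d
      using that stable_hill[OF Suc.prems(1)] unfolding E_def by blast
  qed (use B Suc.prems(2) in auto)
  have "stable h c" using c(3) by (auto simp: stable_def E_def)
  then obtain y where y: "y 0 = c" "trajectory h y" "c \<in> real_vecs \<longrightarrow> (\<forall>m\<le>h. y m \<in> real_vecs)"
    using Suc.IH[of c] c(1,2) Suc.prems(3) by blast
  have "trajectory (Suc h) (case_nat b y)"
    using y(1,2) c Suc.prems(1,2) by (intro trajectory_Cons) (auto intro: stable_imp_C_le)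
  moreover have "b \<in> real_vecs \<longrightarrow> (\<forall>m\<le>Suc h. case_nat b y m \<in> real_vecs)"
    using y(3) c(2) by (auto split: nat.split)
  ultimately show ?case by (intro exI[of _ "case_nat b y"]) simp
qed

text \<open>
  Here the budget is unlimited, so the next state inherits stability at all heights and the
  construction can be iterated forever.
\<close>

lemma stable_imp_infinite_trajectory:
  assumes "b \<in> real_vecs" "\<And>h. stable h b"
  obtains x where "x 0 = b" "\<And>N. trajectory N x" "\<And>m. x m \<in> real_vecs"
proof -
  define P where "P a \<longleftrightarrow> a \<in> real_vecs \<and> (\<forall>h. stable h a)" for a
  have "\<exists>c. P c \<and> (R \<otimes>\<^sub>v a \<le> c \<and> L \<otimes>\<^sub>v c \<le> a)" if "P a" for a
  proof -
    have a: "a \<in> real_vecs" "\<And>h. stable h a" using that by (auto simp: P_def)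
    define E where "E j i w \<longleftrightarrow> (\<exists>s h. excursion s h j i w)" for j i w
    obtain B where B: "\<And>j i w. E j i w \<Longrightarrow> w \<le> B"
      using stable_real_bounded[OF a(1)] a(2) unfolding E_def by metis
    obtain c where c: "c \<in> rmax_vecs" "a \<in> real_vecs \<Longrightarrow> c \<in> real_vecs"
      "\<And>j i w. E j i w \<Longrightarrow> ereal w + c $ j \<le> c $ i" "R \<otimes>\<^sub>v a \<le> c" "L \<otimes>\<^sub>v c \<le> a"
    proof (rule next_level[of E B a])
      show "E i i 0" for i unfolding E_def using excursion.stay by blast
      show "E j i (w + v)" if E: "E j l w" "E l i v" for j l i w v
      proof -
        obtain s h t h' where "excursion s h j l w" "excursion t h' l i v"
          using E unfolding E_def by blast
        then have "excursion s (max h h') j l w" "excursion t (max h h') l i v"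
          by (auto intro: excursion_mono)
        then show ?thesis unfolding E_def using excursion_trans by blast
      qed
      show "ereal (r + v + d) + a $ l \<le> a $ i"
        if "R $ p $ l = ereal r" "E p q v" "L $ i $ q = ereal d" for p l r q v i d
        using that stable_hill[OF a(2)] unfolding E_def by blast
    qed (use B a(1) real_imp_rmax_vecs in auto)
    have "P c" using c(2)[OF a(1)] c(3) unfolding P_def stable_def E_def by blast
    then show ?thesis using c(4,5) by blast
  qed
  then obtain f where f: "\<And>a. P a \<Longrightarrow> P (f a) \<and> R \<otimes>\<^sub>v a \<le> f a \<and> L \<otimes>\<^sub>v f a \<le> a"
    by metis
  define x where "x m = (f ^^ m) b" for m
  have "P b" using assms by (simp add: P_def)
  then have P: "P (x m)" for m by (induction m) (auto simp: x_def f)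
  have x: "x 0 = b" "R \<otimes>\<^sub>v x m \<le> x (Suc m) \<and> L \<otimes>\<^sub>v x (Suc m) \<le> x m" for m
    using f[OF P, of m] by (simp_all add: x_def)
  have "trajectory N x" for N
    using P x(2) real_imp_rmax_vecs stable_imp_C_le unfolding trajectory_def P_def by blast
  then show ?thesis using that[of x] x(1) P unfolding P_def by blast
qed


section \<open>Pumping excursions\<close>

text \<open>
  \<open>nests k u a a'\<close> expresses that an excursion with end points \<open>a'\<close> can be replaced by one with end
  points \<open>a\<close> at the price of \<open>k\<close> rule applications and weight \<open>u\<close>: there is a climb and a descent
  around a hole. Stating this by its effect on excursions makes composition and repetition of such
  contexts immediate.
\<close>

definition nests :: "nat \<Rightarrow> real \<Rightarrow> 'n \<times> 'n \<Rightarrow> 'n \<times> 'n \<Rightarrow> bool" where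
  "nests k u a a' \<longleftrightarrow> (\<forall>t h v. excursion t h (fst a') (snd a') v \<longrightarrow>
     (\<exists>h'. excursion (k + t) h' (fst a) (snd a) (u + v)))"

lemma nests_refl: "nests 0 0 a a"
  by (auto simp: nests_def)

lemma nests_trans:
  assumes "nests k u a a'" "nests k' u' a' a''"
  shows "nests (k + k') (u + u') a a''"
  unfolding nests_def add.assoc using assms unfolding nests_def by blast

lemma nests_pump: "nests k u a a \<Longrightarrow> nests (m * k) (real m * u) a a"
  by (induction m) (auto simp: nests_refl distrib_right intro: nests_trans)

text \<open>
  If height \<open>h\<close> does not suffice, some hill reaches height \<open>Suc h\<close>, and everything outside this hill
  is a context. The last conjunct makes the peeling repeatable: the inside of the hill in turn needs
  its full height.
\<close>

lemma excursion_peel: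
  assumes "excursion s (Suc h) j i w" "\<not> excursion s h j i w"
  shows "\<exists>k u p q t v. 0 < k \<and> nests k u (j, i) (p, q) \<and> excursion t h p q v \<and> s = k + t \<and>
    w = u + v \<and> (\<forall>g. h = Suc g \<longrightarrow> \<not> excursion t g p q v)"
  using assms
proof (induction s "Suc h" j i w rule: excursion.induct)
  case (stay i)
  then show ?case by (simp add: excursion.stay)
next
  case (level s j l w i c)
  have "\<not> excursion s h j l w" using level.prems excursion.level[OF _ level.hyps(3)] by auto
  then obtain k u p q t v where *: "0 < k" "nests k u (j, l) (p, q)" "excursion t h p q v"
    "s = k + t" "w = u + v" "\<forall>g. h = Suc g \<longrightarrow> \<not> excursion t g p q v"
    using level by blast
  have "nests (Suc k) (u + c) (j, i) (p, q)"
    unfolding nests_def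
  proof (intro allI impI)
    fix t h v assume "excursion t h (fst (p, q)) (snd (p, q)) v"
    then obtain h' where "excursion (k + t) h' j l (u + v)"
      using *(2) unfolding nests_def by fastforce
    from excursion.level[OF this, of i c] level.hyps
    show "\<exists>h'. excursion (Suc k + t) h' (fst (j, i)) (snd (j, i)) (u + c + v)"
      by (intro exI[of _ h']) (simp add: ac_simps)
  qed
  then show ?case
    using * by (intro exI[of _ "Suc k"] exI[of _ "u + c"] exI[of _ p] exI[of _ q] exI[of _ t] exI[of _ v]) simp
next
  case (hill s j l w p' r t' q' v' i d)
  show ?case
  proof (cases "excursion s h j l w")
    \<comment> \<open>The full height is reached before the final hill, which becomes part of the descent.\<close>
    case False
    then obtain k u p q t v where *: "0 < k" "nests k u (j, l) (p, q)" "excursion t h p q v"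
      "s = k + t" "w = u + v" "\<forall>g. h = Suc g \<longrightarrow> \<not> excursion t g p q v"
      using hill by blast
    have "nests (Suc (k + t')) (u + (r + v' + d)) (j, i) (p, q)"
      unfolding nests_def
    proof (intro allI impI)
      fix t h0 v assume "excursion t h0 (fst (p, q)) (snd (p, q)) v"
      then obtain h' where "excursion (k + t) h' j l (u + v)"
        using *(2) unfolding nests_def by fastforce
      then have "excursion (k + t) (Suc (max h h')) j l (u + v)" by (rule excursion_mono) simp
      moreover have "excursion t' (max h h') p' q' v'"
        using hill.hyps(4) by (rule excursion_mono) simp
      ultimately have "excursion (Suc (k + t + t')) (Suc (max h h')) j i (u + v + (r + v' + d))"
        by (rule excursion.hill[OF _ hill.hyps(3) _ hill.hyps(6)])
      then show "\<exists>h'. excursion (Suc (k + t') + t) h' (fst (j, i)) (snd (j, i)) (u + (r + v' + d) + v)"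
        by (intro exI[of _ "Suc (max h h')"]) (simp add: ac_simps)
    qed
    then show ?thesis
      using * by (intro exI[of _ "Suc (k + t')"] exI[of _ "u + (r + v' + d)"] exI[of _ p] exI[of _ q]
          exI[of _ t] exI[of _ v]) simp
  next
    \<comment> \<open>The final hill itself has the full height, and its inside fills the hole.\<close>
    case True
    have "nests (Suc s) (w + r + d) (j, i) (p', q')"
      unfolding nests_def
    proof (intro allI impI)
      fix t h0 v assume "excursion t h0 (fst (p', q')) (snd (p', q')) v"
      then have "excursion t (max h h0) p' q' v" by (auto intro: excursion_mono)
      moreover have "excursion s (Suc (max h h0)) j l w" using True by (rule excursion_mono) simp
      ultimately have "excursion (Suc (s + t)) (Suc (max h h0)) j i (w + (r + v + d))"
        by (intro excursion.hill[OF _ hill.hyps(3) _ hill.hyps(6)])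
      then show "\<exists>h'. excursion (Suc s + t) h' (fst (j, i)) (snd (j, i)) (w + r + d + v)"
        by (intro exI[of _ "Suc (max h h0)"]) (simp add: ac_simps)
    qed
    moreover have "\<not> excursion t' g p' q' v'" if "h = Suc g" for g
      using hill.prems True excursion.hill[OF _ hill.hyps(3) _ hill.hyps(6)] that by blast
    ultimately show ?thesis
      using hill.hyps(4) by (intro exI[of _ "Suc s"] exI[of _ "w + r + d"] exI[of _ p'] exI[of _ q']
          exI[of _ t'] exI[of _ v']) simp
  qed
qed

text \<open>
  Peeling one level at a time: \<open>a m\<close> are the indices at which the path enters and leaves level
  \<open>m\<close> around its summit, and \<open>\<sigma> m\<close>, \<open>\<omega> m\<close> are the size and
  the weight of the part between these two points.
\<close>

lemma excursion_chain:
  assumes "excursion s H j i w" "\<And>g. g < H \<Longrightarrow> \<not> excursion s g j i w"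
  shows "\<exists>a \<sigma> \<omega>. a 0 = (j, i) \<and> \<sigma> 0 = s \<and> \<omega> 0 = w \<and>
    (\<forall>m\<le>H. excursion (\<sigma> m) (H - m) (fst (a m)) (snd (a m)) (\<omega> m)) \<and>
    (\<forall>m<H. \<sigma> (Suc m) < \<sigma> m \<and> nests (\<sigma> m - \<sigma> (Suc m)) (\<omega> m - \<omega> (Suc m)) (a m) (a (Suc m)))"
  using assms
proof (induction H arbitrary: s j i w)
  case 0
  then show ?case
    by (intro exI[of _ "\<lambda>_. (j, i)"] exI[of _ "\<lambda>_. s"] exI[of _ "\<lambda>_. w"]) simp
next
  case (Suc H)
  obtain k u p q t v where *: "0 < k" "nests k u (j, i) (p, q)" "excursion t H p q v"
    "s = k + t" "w = u + v" "\<forall>g. H = Suc g \<longrightarrow> \<not> excursion t g p q v"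
    using excursion_peel[OF Suc.prems(1)] Suc.prems(2) by blast
  have "\<not> excursion t g p q v" if g: "g < H" for g
  proof -
    obtain g' where "H = Suc g'" "g \<le> g'" using g by (cases H) auto
    then show ?thesis using *(6) excursion_mono by blast
  qed
  then obtain a \<sigma> \<omega> where IH: "a 0 = (p, q)" "\<sigma> 0 = t" "\<omega> 0 = v"
    "\<forall>m\<le>H. excursion (\<sigma> m) (H - m) (fst (a m)) (snd (a m)) (\<omega> m)"
    "\<forall>m<H. \<sigma> (Suc m) < \<sigma> m \<and> nests (\<sigma> m - \<sigma> (Suc m)) (\<omega> m - \<omega> (Suc m)) (a m) (a (Suc m))"
    using Suc.IH[OF *(3)] by blast
  show ?case
    using IH * Suc.prems(1)
    by (intro exI[of _ "case_nat (j, i) a"] exI[of _ "case_nat s \<sigma>"] exI[of _ "case_nat w \<omega>"])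
      (auto split: nat.split)
qed

text \<open>
  There are \<open>n\<^sup>2\<close> pairs of indices but \<open>H + 1 > n\<^sup>2\<close> levels \<open>0, \<dots>, H\<close>, so two levels
  share their pair and the part between them is a loop that can be cut out or repeated. A cut reduces
  the size, although not necessarily the height, since there may be several summits; hence the
  induction on the size.
\<close>

lemma excursion_height_reduce:
  assumes bounded_excursions "excursion s h j i w"
  shows "\<exists>s' w'. w \<le> w' \<and> excursion s' ((CARD('n))\<^sup>2 - 1) j i w'"
  using assms(2)
proof (induction s arbitrary: h w rule: less_induct)
  case (less s)
  \<comment> \<open>The true height, so that every level up to it is really visited and can be peeled off.\<close>
  define H where "H = (LEAST h. excursion s h j i w)"
  have H: "excursion s H j i w" unfolding H_def using less.prems by (rule LeastI)
  have minimal: "\<not> excursion s g j i w" if "g < H" for g using that not_less_Least unfolding H_def by blast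
  show ?case
  proof (cases "H \<le> (CARD('n))\<^sup>2 - 1")
    case True
    then show ?thesis using excursion_mono[OF H] by blast
  next
    case False
    obtain a \<sigma> \<omega> where chain: "a 0 = (j, i)" "\<sigma> 0 = s" "\<omega> 0 = w"
      "\<And>m. m \<le> H \<Longrightarrow> excursion (\<sigma> m) (H - m) (fst (a m)) (snd (a m)) (\<omega> m)"
      "\<And>m. m < H \<Longrightarrow> \<sigma> (Suc m) < \<sigma> m \<and>
        nests (\<sigma> m - \<sigma> (Suc m)) (\<omega> m - \<omega> (Suc m)) (a m) (a (Suc m))"
      using excursion_chain[OF H minimal] by blast
    have link: "\<sigma> m' \<le> \<sigma> m \<and> (m < m' \<longrightarrow> \<sigma> m' < \<sigma> m) \<and> nests (\<sigma> m - \<sigma> m') (\<omega> m - \<omega> m') (a m) (a m')"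
      if "m \<le> m'" "m' \<le> H" for m m'
      using that
    proof (induction m' rule: dec_induct)
      case base
      then show ?case by (simp add: nests_refl)
    next
      case (step m')
      then have "\<sigma> m' \<le> \<sigma> m" "\<sigma> (Suc m') < \<sigma> m'" by (auto simp: chain(5))
      moreover have "nests ((\<sigma> m - \<sigma> m') + (\<sigma> m' - \<sigma> (Suc m')))
          ((\<omega> m - \<omega> m') + (\<omega> m' - \<omega> (Suc m'))) (a m) (a (Suc m'))"
        using step chain(5)[of m'] by (intro nests_trans) auto
      ultimately show ?case by simp
    qed
    have "CARD('n \<times> 'n) < card {..H}" using False by (simp add: power2_eq_square)
    then have "\<not> inj_on a {..H}" using card_mono[of UNIV "a ` {..H}"] card_image[of a "{..H}"] by auto
    then obtain m m' where mm: "m < m'" "m' \<le> H" "a m = a m'"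
      unfolding inj_on_def by (metis atMost_iff linorder_neqE_nat)
    define u where "u = \<omega> m - \<omega> m'"
    have pre: "nests (s - \<sigma> m) (w - \<omega> m) (j, i) (a m)" "\<sigma> m \<le> s"
      using link[of 0 m] mm chain by auto
    have loop: "nests (\<sigma> m - \<sigma> m') u (a m) (a m)" "\<sigma> m' < \<sigma> m"
      using link[of m m'] mm by (auto simp: u_def)
    show ?thesis
    proof (cases "u \<le> 0")
      \<comment> \<open>Cutting out the loop does not lose weight.\<close>
      case True
      have "excursion (\<sigma> m') (H - m') (fst (a m)) (snd (a m)) (\<omega> m')"
        using chain(4)[of m'] mm by simp
      then obtain h' where "excursion (s - \<sigma> m + \<sigma> m') h' j i (w - \<omega> m + \<omega> m')"
        using pre(1) unfolding nests_def by fastforce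
      moreover have "s - \<sigma> m + \<sigma> m' < s" using pre(2) loop(2) by simp
      ultimately obtain s' w' where "w - \<omega> m + \<omega> m' \<le> w'" "excursion s' ((CARD('n))\<^sup>2 - 1) j i w'"
        using less.IH by blast
      then show ?thesis using True by (intro exI[of _ s'] exI[of _ w']) (simp add: u_def)
    next
      \<comment> \<open>Repeating the loop often enough exceeds the bound.\<close>
      case False
      obtain B where B: "\<And>s h j i w. excursion s h j i w \<Longrightarrow> w \<le> B"
        using assms(1) unfolding bounded_excursions_def by blast
      obtain k where k: "B - w < real k * u" using False reals_Archimedean3[of u] by auto
      have "nests (s - \<sigma> m + k * (\<sigma> m - \<sigma> m')) (w - \<omega> m + real k * u) (j, i) (a m)"
        using nests_trans[OF pre(1) nests_pump[OF loop(1)]] .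
      moreover have "excursion (\<sigma> m) (H - m) (fst (a m)) (snd (a m)) (\<omega> m)"
        using chain(4)[of m] mm by simp
      ultimately obtain s' h' where "excursion s' h' j i (w - \<omega> m + real k * u + \<omega> m)"
        unfolding nests_def by fastforce
      then show ?thesis using B k by force
    qed
  qed
qed

lemma stable_all_heights:
  assumes bounded_excursions "stable ((CARD('n))\<^sup>2 - 1) b"
  shows "stable h b"
  unfolding stable_def
proof (intro allI impI)
  fix s j i w assume "excursion s h j i w"
  then obtain s' w' where w': "w \<le> w'" "excursion s' ((CARD('n))\<^sup>2 - 1) j i w'"
    using excursion_height_reduce[OF assms(1)] by blast
  have "ereal w + b $ j \<le> ereal w' + b $ j" using w'(1) by (intro add_right_mono) simp
  also have "\<dots> \<le> b $ i" using w'(2) assms(2) by (auto simp: stable_def)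
  finally show "ereal w + b $ j \<le> b $ i" .
qed


section \<open>Trajectories and the control system\<close>

definition join :: "ereal^'n \<Rightarrow> ereal^'n \<Rightarrow> ereal^('n + 'n)" where
  "join a b = (\<chi> i. case i of Inl i' \<Rightarrow> a $ i' | Inr i' \<Rightarrow> b $ i')"

lemma join_exhaust: obtains a b where "z = join a b"
proof
  show "z = join (\<chi> i. z $ Inl i) (\<chi> i. z $ Inr i)"
    by (simp add: join_def vec_eq_iff split: sum.split)
qed

lemma all_sum_iff: "(\<forall>i. P i) \<longleftrightarrow> (\<forall>a. P (Inl a)) \<and> (\<forall>b. P (Inr b))"
  by (metis sum.exhaust)

lemma join_eq_iff [simp]: "join a b = join c d \<longleftrightarrow> a = c \<and> b = d"
  by (simp add: join_def vec_eq_iff all_sum_iff)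

lemma join_mem_rmax_iff [simp]: "join a b \<in> rmax_vecs \<longleftrightarrow> a \<in> rmax_vecs \<and> b \<in> rmax_vecs"
  by (simp add: rmax_vecs_def all_sum_iff join_def)

lemma join_mem_real_iff [simp]: "join a b \<in> real_vecs \<longleftrightarrow> a \<in> real_vecs \<and> b \<in> real_vecs"
  by (simp add: real_vecs_def all_sum_iff join_def)

text \<open>
  The control system is a shift register: the input is the new state and the previous one moves to the
  first half. Thus controlled trajectories in the semimodule are trajectories of the inequalities.
\<close>

lemma control_step: "A_bar \<otimes>\<^sub>v join a b \<oplus>\<^sub>v B_bar \<otimes>\<^sub>v u = join b u"
proof -
  have upper: "(A_bar \<otimes>\<^sub>v join a b) $ Inl i = b $ i" for i
  proof (rule antisym)
    show "(A_bar \<otimes>\<^sub>v join a b) $ Inl i \<le> b $ i"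
      unfolding mat_vec_def vec_lambda_beta
      by (rule SUP_least)
        (simp add: A_bar_def block_mat_def join_def mp_zero_def mp_id_def otimes_def split: sum.split)
    show "b $ i \<le> (A_bar \<otimes>\<^sub>v join a b) $ Inl i"
      unfolding mat_vec_def vec_lambda_beta
      by (rule SUP_upper2[of "Inr i"])
        (simp_all add: A_bar_def block_mat_def join_def mp_id_def otimes_def)
  qed
  have "A_bar $ Inr i $ j = - \<infinity>" for i :: 'n and j :: "'n + 'n"
    by (simp add: A_bar_def block_mat_def mp_zero_def split: sum.split)
  then have lower: "(A_bar \<otimes>\<^sub>v join a b) $ Inr i = - \<infinity>" for i
    by (simp add: mat_vec_def otimes_def)
  have B_upper: "(B_bar \<otimes>\<^sub>v u) $ Inl i = - \<infinity>" for i
    by (simp add: mat_vec_def B_bar_def block_col_def mp_zero_def otimes_def)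
  have B_lower: "(B_bar \<otimes>\<^sub>v u) $ Inr i = u $ i" for i
  proof (rule antisym)
    show "(B_bar \<otimes>\<^sub>v u) $ Inr i \<le> u $ i"
      unfolding mat_vec_def vec_lambda_beta
      by (rule SUP_least) (simp add: B_bar_def block_col_def mp_id_def otimes_def)
    show "u $ i \<le> (B_bar \<otimes>\<^sub>v u) $ Inr i"
      unfolding mat_vec_def vec_lambda_beta
      by (rule SUP_upper2[of i]) (simp_all add: B_bar_def block_col_def mp_id_def otimes_def)
  qed
  show ?thesis
    by (simp add: vec_eq_iff all_sum_iff vec_oplus_def upper lower B_upper B_lower) (simp add: join_def)
qed

lemma join_mem_K_iff:
  "join a b \<in> K_mod L C R \<longleftrightarrow> a \<in> rmax_vecs \<and> b \<in> rmax_vecs \<and> C \<otimes>\<^sub>v a \<le> a \<and> L \<otimes>\<^sub>v b \<le> a \<and>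
     R \<otimes>\<^sub>v a \<le> b \<and> C \<otimes>\<^sub>v b \<le> b"
proof -
  have "H_mat L C R \<otimes>\<^sub>v join a b \<le> join a b \<longleftrightarrow>
      C \<otimes>\<^sub>v a \<le> a \<and> L \<otimes>\<^sub>v b \<le> a \<and> R \<otimes>\<^sub>v a \<le> b \<and> C \<otimes>\<^sub>v b \<le> b"
    unfolding mat_vec_le_iff all_sum_iff H_mat_def block_mat_def join_def vec_lambda_beta sum.case
    by blast
  then show ?thesis by (simp add: K_mod_def)
qed

lemma join_mem_phi_iff:
  "join a b \<in> phi A_bar B_bar X \<longleftrightarrow>
     join a b \<in> X \<and> a \<in> rmax_vecs \<and> b \<in> rmax_vecs \<and> (\<exists>c\<in>rmax_vecs. join b c \<in> X)"
  unfolding phi_def by (auto simp: control_step)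

text \<open>
  A pair already carries one transition, and each application of \<open>\<phi>\<close> asks for one more.
\<close>

lemma join_mem_phi_power_iff:
  "join a b \<in> (phi A_bar B_bar ^^ k) (K_mod L C R) \<longleftrightarrow> (\<exists>x. trajectory (Suc k) x \<and> x 0 = a \<and> x 1 = b)"
proof (induction k arbitrary: a b)
  case 0
  have "(\<exists>x. trajectory (Suc 0) x \<and> x 0 = a \<and> x 1 = b) \<longleftrightarrow> trajectory (Suc 0) (case_nat a (\<lambda>_. b))"
    by (auto simp: trajectory_def le_Suc_eq intro: exI[of _ "case_nat a (\<lambda>_. b)"])
  also have "\<dots> \<longleftrightarrow> join a b \<in> K_mod L C R"
    by (auto simp: trajectory_def le_Suc_eq join_mem_K_iff)
  finally show ?case by simp
next
  case (Suc k)
  show ?case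
  proof
    assume "join a b \<in> (phi A_bar B_bar ^^ Suc k) (K_mod L C R)"
    then have "join a b \<in> (phi A_bar B_bar ^^ k) (K_mod L C R)"
      "\<exists>c. join b c \<in> (phi A_bar B_bar ^^ k) (K_mod L C R)"
      by (auto simp: join_mem_phi_iff)
    then obtain x y where x: "trajectory (Suc k) x" "x 0 = a" "x 1 = b"
      and y: "trajectory (Suc k) y" "y 0 = b" unfolding Suc by blast
    have "trajectory (Suc (Suc k)) (case_nat a y)"
      using x y by (intro trajectory_Cons) (auto simp: trajectory_def)
    then show "\<exists>x. trajectory (Suc (Suc k)) x \<and> x 0 = a \<and> x 1 = b"
      using y by (intro exI[of _ "case_nat a y"]) simp
  next
    assume "\<exists>x. trajectory (Suc (Suc k)) x \<and> x 0 = a \<and> x 1 = b"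
    then obtain x where x: "trajectory (Suc (Suc k)) x" "x 0 = a" "x 1 = b" by blast
    have "join a b \<in> (phi A_bar B_bar ^^ k) (K_mod L C R)"
      unfolding Suc using x trajectory_antimono[OF x(1), of "Suc k"] by auto
    moreover have "join b (x 2) \<in> (phi A_bar B_bar ^^ k) (K_mod L C R)"
      unfolding Suc using x trajectory_tl[OF x(1)]
      by (intro exI[of _ "\<lambda>m. x (Suc m)"]) (simp add: numeral_2_eq_2)
    moreover have "a \<in> rmax_vecs" "b \<in> rmax_vecs" "x 2 \<in> rmax_vecs"
      using x by (auto simp: trajectory_def)
    ultimately show "join a b \<in> (phi A_bar B_bar ^^ Suc k) (K_mod L C R)"
      by (auto simp: join_mem_phi_iff)
  qed
qed

lemma join_mem_max_invariant_iff:
  "join a b \<in> max_invariant A_bar B_bar (K_mod L C R) \<longleftrightarrow>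
     (\<exists>x. (\<forall>N. trajectory N x) \<and> x 0 = a \<and> x 1 = b)"
proof
  assume "join a b \<in> max_invariant A_bar B_bar (K_mod L C R)"
  then obtain u z where uz: "controlled_traj A_bar B_bar u z" "z 0 = join a b" "\<And>k. z k \<in> K_mod L C R"
    unfolding max_invariant_eq(1)[OF semimodule_K_mod] by blast
  define x where "x = case_nat a (case_nat b u)"
  have z: "z k = join (x k) (x (Suc k))" for k
  proof (induction k)
    case 0
    then show ?case by (simp add: uz(2) x_def)
  next
    case (Suc k)
    then have "z (Suc k) = join (x (Suc k)) (u k)"
      using uz(1) by (simp add: controlled_traj_def control_step)
    then show ?case by (simp add: x_def)
  qed
  have "trajectory N x" for N
    using uz(3) unfolding z join_mem_K_iff by (simp add: trajectory_def)
  then show "\<exists>x. (\<forall>N. trajectory N x) \<and> x 0 = a \<and> x 1 = b"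
    by (intro exI[of _ x]) (simp add: x_def)
next
  assume "\<exists>x. (\<forall>N. trajectory N x) \<and> x 0 = a \<and> x 1 = b"
  then obtain x where x: "\<And>N. trajectory N x" "x 0 = a" "x 1 = b" by blast
  have "x m \<in> rmax_vecs \<and> C \<otimes>\<^sub>v x m \<le> x m \<and> L \<otimes>\<^sub>v x (Suc m) \<le> x m \<and> R \<otimes>\<^sub>v x m \<le> x (Suc m)" for m
    using x(1)[of "Suc m"] by (auto simp: trajectory_def)
  then have "controlled_traj A_bar B_bar (\<lambda>k. x (k + 2)) (\<lambda>k. join (x k) (x (Suc k))) \<and>
      (\<forall>k. join (x k) (x (Suc k)) \<in> K_mod L C R)"
    by (simp add: controlled_traj_def control_step join_mem_K_iff)
  then show "join a b \<in> max_invariant A_bar B_bar (K_mod L C R)"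
    unfolding max_invariant_eq(1)[OF semimodule_K_mod] using x(2,3) by force
qed

lemma consistent_iff_stable: "consistent L C R \<longleftrightarrow> (\<exists>b\<in>real_vecs. \<forall>h. stable h b)"
proof
  assume "consistent L C R"
  then obtain x :: "nat \<Rightarrow> ereal^'n" where x: "\<And>k. 1 \<le> k \<Longrightarrow> x k \<in> real_vecs \<and> L \<otimes>\<^sub>v x (k + 1) \<le> x k \<and>
      C \<otimes>\<^sub>v x k \<le> x k \<and> R \<otimes>\<^sub>v x k \<le> x (k + 1)"
    unfolding consistent_def by metis
  have "trajectory N (\<lambda>m. x (Suc m))" for N
    using x real_imp_rmax_vecs by (auto simp: trajectory_def)
  then have "stable h (x (Suc 0))" for h using trajectory_stable[of h _ 0 h] by auto
  then show "\<exists>b\<in>real_vecs. \<forall>h. stable h b" using x[of 1] by auto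
next
  assume "\<exists>b\<in>real_vecs. \<forall>h. stable h b"
  then obtain x where x: "\<And>N. trajectory N x" "\<And>m. x m \<in> real_vecs"
    using stable_imp_infinite_trajectory by metis
  have "x k \<in> real_vecs \<and> L \<otimes>\<^sub>v x (k + 1) \<le> x k \<and> C \<otimes>\<^sub>v x k \<le> x k \<and> R \<otimes>\<^sub>v x k \<le> x (k + 1)" for k
    using x(1)[of "Suc k"] x(2) by (auto simp: trajectory_def)
  then show "consistent L C R" unfolding consistent_def by blast
qed

lemma weakly_consistent_iff_stable:
  "weakly_consistent L C R \<longleftrightarrow> (\<forall>h. \<exists>b\<in>real_vecs. stable h b)"
proof
  assume wc: "weakly_consistent L C R"
  show "\<forall>h. \<exists>b\<in>real_vecs. stable h b"
  proof
    fix h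
    obtain x where x: "\<forall>k\<in>{1..Suc h}. x k \<in> real_vecs \<and> C \<otimes>\<^sub>v x k \<le> x k"
      "\<forall>k\<in>{1..<Suc h}. L \<otimes>\<^sub>v x (k + 1) \<le> x k \<and> R \<otimes>\<^sub>v x k \<le> x (k + 1)"
      using wc unfolding weakly_consistent_def by (metis le_add2 Suc_eq_plus1)
    have "x (Suc m) \<in> rmax_vecs" if "m \<le> h" for m using x(1) that by (intro real_imp_rmax_vecs) simp
    then have "trajectory h (\<lambda>m. x (Suc m))" "x (Suc 0) \<in> real_vecs"
      using x by (auto simp: trajectory_def)
    then show "\<exists>b\<in>real_vecs. stable h b" using trajectory_stable[of h _ 0 h] by auto
  qed
next
  assume stable: "\<forall>h. \<exists>b\<in>real_vecs. stable h b"
  show "weakly_consistent L C R"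
    unfolding weakly_consistent_def
  proof (intro allI impI)
    fix N :: nat assume "1 \<le> N"
    then obtain N' where N: "N = Suc N'" by (cases N) auto
    obtain b where "b \<in> real_vecs" "stable N' b" using stable by blast
    then obtain x where "trajectory N' x" "\<forall>m\<le>N'. x m \<in> real_vecs"
      using stable_imp_trajectory real_imp_rmax_vecs by metis
    then have "x (k - 1) \<in> real_vecs \<and> C \<otimes>\<^sub>v x (k - 1) \<le> x (k - 1)" if "k \<in> {1..N}" for k
      using that by (auto simp: trajectory_def N)
    moreover have "L \<otimes>\<^sub>v x (k + 1 - 1) \<le> x (k - 1) \<and> R \<otimes>\<^sub>v x (k - 1) \<le> x (k + 1 - 1)"
      if "k \<in> {1..<N}" for k
      using \<open>trajectory N' x\<close> that by (cases k) (auto simp: trajectory_def N)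
    ultimately show "\<exists>x. (\<forall>k\<in>{1..N}. x k \<in> real_vecs \<and> C \<otimes>\<^sub>v x k \<le> x k) \<and>
        (\<forall>k\<in>{1..<N}. L \<otimes>\<^sub>v x (k + 1) \<le> x k \<and> R \<otimes>\<^sub>v x k \<le> x (k + 1))"
      by (intro exI[of _ "\<lambda>k. x (k - 1)"]) blast
  qed
qed

lemma max_invariant_real_iff_consistent:
  "max_invariant A_bar B_bar (K_mod L C R) \<inter> real_vecs \<noteq> {} \<longleftrightarrow> consistent L C R"
proof
  assume "max_invariant A_bar B_bar (K_mod L C R) \<inter> real_vecs \<noteq> {}"
  then obtain a b where ab: "join a b \<in> max_invariant A_bar B_bar (K_mod L C R)" "a \<in> real_vecs"
    by (metis IntE all_not_in_conv join_exhaust join_mem_real_iff)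
  then obtain x where "\<And>N. trajectory N x" "x 0 = a" unfolding join_mem_max_invariant_iff by blast
  then have "stable h a" for h using trajectory_stable[of h x 0 h] by auto
  then show "consistent L C R" using ab(2) consistent_iff_stable by blast
next
  assume "consistent L C R"
  then obtain x where "\<And>N. trajectory N x" "\<And>m. x m \<in> real_vecs"
    using stable_imp_infinite_trajectory unfolding consistent_iff_stable by metis
  then have "join (x 0) (x 1) \<in> max_invariant A_bar B_bar (K_mod L C R) \<inter> real_vecs"
    unfolding Int_iff join_mem_max_invariant_iff by auto
  then show "max_invariant A_bar B_bar (K_mod L C R) \<inter> real_vecs \<noteq> {}" by blast
qed

text \<open>
  The extension required by \<open>\<phi>\<close> may use entries minus infinity. Stability of the real first half
  nevertheless yields a trajectory all of whose states are real.
\<close>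

lemma phi_power_real_iff_stable:
  "(phi A_bar B_bar ^^ k) (K_mod L C R) \<inter> real_vecs \<noteq> {} \<longleftrightarrow> (\<exists>b\<in>real_vecs. stable (Suc k) b)"
proof
  assume "(phi A_bar B_bar ^^ k) (K_mod L C R) \<inter> real_vecs \<noteq> {}"
  then obtain a b where ab: "join a b \<in> (phi A_bar B_bar ^^ k) (K_mod L C R)" "a \<in> real_vecs"
    by (metis IntE all_not_in_conv join_exhaust join_mem_real_iff)
  then obtain x where "trajectory (Suc k) x" "x 0 = a" unfolding join_mem_phi_power_iff by blast
  then have "stable (Suc k) a" using trajectory_stable[of "Suc k" x 0 "Suc k"] by auto
  then show "\<exists>b\<in>real_vecs. stable (Suc k) b" using ab(2) by blast
next
  assume "\<exists>b\<in>real_vecs. stable (Suc k) b"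
  then obtain x where "trajectory (Suc k) x" "\<forall>m\<le>Suc k. x m \<in> real_vecs"
    using stable_imp_trajectory real_imp_rmax_vecs by metis
  then have "join (x 0) (x 1) \<in> (phi A_bar B_bar ^^ k) (K_mod L C R) \<inter> real_vecs"
    unfolding Int_iff join_mem_phi_power_iff by auto
  then show "(phi A_bar B_bar ^^ k) (K_mod L C R) \<inter> real_vecs \<noteq> {}" by blast
qed

lemma phi_power_real_empty_iff:
  "(\<exists>k0. \<forall>k\<ge>k0. (phi A_bar B_bar ^^ k) (K_mod L C R) \<inter> real_vecs = {}) \<longleftrightarrow>
     \<not> weakly_consistent L C R"
proof
  assume "\<exists>k0. \<forall>k\<ge>k0. (phi A_bar B_bar ^^ k) (K_mod L C R) \<inter> real_vecs = {}"
  then show "\<not> weakly_consistent L C R"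
    unfolding weakly_consistent_iff_stable by (metis phi_power_real_iff_stable order_refl)
next
  assume "\<not> weakly_consistent L C R"
  then obtain h where h: "\<And>b. b \<in> real_vecs \<Longrightarrow> \<not> stable h b"
    unfolding weakly_consistent_iff_stable by blast
  have "(phi A_bar B_bar ^^ k) (K_mod L C R) \<inter> real_vecs = {}" if "h \<le> k" for k
    using phi_power_real_iff_stable[of k] h stable_antimono[of "Suc k" _ h] that by fastforce
  then show "\<exists>k0. \<forall>k\<ge>k0. (phi A_bar B_bar ^^ k) (K_mod L C R) \<inter> real_vecs = {}" by blast
qed

lemma consistent_imp_bounded_excursions:
  assumes "consistent L C R"
  shows bounded_excursions
  using assms stable_real_bounded unfolding consistent_iff_stable bounded_excursions_def by metis

text \<open>
  A trajectory with \<open>n\<^sup>2\<close> transitions leaves \<open>n\<^sup>2 - 1\<close> of them after its second state,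
  which is exactly the height at which stability becomes stability at all heights. The continuation
  can then be replaced by one of any length without changing the first two states.
\<close>

lemma consistent_imp_phi_power_eq:
  assumes "consistent L C R" "(CARD('n))\<^sup>2 - 1 \<le> k"
  shows "(phi A_bar B_bar ^^ k) (K_mod L C R) = (phi A_bar B_bar ^^ ((CARD('n))\<^sup>2 - 1)) (K_mod L C R)"
proof -
  have bounded: bounded_excursions using assms(1) by (rule consistent_imp_bounded_excursions)
  have "join a b \<in> (phi A_bar B_bar ^^ k) (K_mod L C R) \<longleftrightarrow>
      join a b \<in> (phi A_bar B_bar ^^ ((CARD('n))\<^sup>2 - 1)) (K_mod L C R)" for a b
    unfolding join_mem_phi_power_iff
  proof
    assume "\<exists>x. trajectory (Suc k) x \<and> x 0 = a \<and> x 1 = b"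
    then show "\<exists>x. trajectory (Suc ((CARD('n))\<^sup>2 - 1)) x \<and> x 0 = a \<and> x 1 = b"
      using trajectory_antimono[OF _ Suc_le_mono[THEN iffD2, OF assms(2)]] by blast
  next
    assume "\<exists>x. trajectory (Suc ((CARD('n))\<^sup>2 - 1)) x \<and> x 0 = a \<and> x 1 = b"
    then obtain x where x: "trajectory (Suc ((CARD('n))\<^sup>2 - 1)) x" "x 0 = a" "x 1 = b" by blast
    have "stable ((CARD('n))\<^sup>2 - 1) b" using trajectory_stable[OF x(1), of 1] x(3) by simp
    then have "stable k b" by (rule stable_all_heights[OF bounded])
    moreover have "b \<in> rmax_vecs" using x by (auto simp: trajectory_def)
    ultimately obtain y where y: "y 0 = b" "trajectory k y"
      using stable_imp_trajectory bounded by blast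
    have "trajectory (Suc k) (case_nat a y)"
      using x y by (intro trajectory_Cons) (auto simp: trajectory_def)
    then show "\<exists>x. trajectory (Suc k) x \<and> x 0 = a \<and> x 1 = b"
      using y by (intro exI[of _ "case_nat a y"]) simp
  qed
  then show ?thesis by (metis join_exhaust subset_antisym subsetI)
qed

text \<open>
  By weak consistency the constant value is nonempty, and the first half of any of its elements starts
  trajectories of all lengths.
\<close>

lemma eventually_constant_imp_consistent:
  assumes "weakly_consistent L C R"
    and const: "\<And>k. k0 \<le> k \<Longrightarrow> (phi A_bar B_bar ^^ k) (K_mod L C R) \<inter> real_vecs =
      (phi A_bar B_bar ^^ k0) (K_mod L C R) \<inter> real_vecs"
  shows "consistent L C R"
proof -
  have "(phi A_bar B_bar ^^ k0) (K_mod L C R) \<inter> real_vecs \<noteq> {}"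
    using assms(1) unfolding phi_power_real_iff_stable weakly_consistent_iff_stable by blast
  then obtain a b where ab: "join a b \<in> (phi A_bar B_bar ^^ k0) (K_mod L C R)" "join a b \<in> real_vecs"
    by (metis IntE all_not_in_conv join_exhaust)
  have "stable h a" for h
  proof -
    have "join a b \<in> (phi A_bar B_bar ^^ (max k0 h)) (K_mod L C R)"
      using ab const[OF max.cobounded1, of h] by blast
    then obtain x where "trajectory (Suc (max k0 h)) x" "x 0 = a"
      unfolding join_mem_phi_power_iff by blast
    then show ?thesis using trajectory_stable[of _ x 0 h] by fastforce
  qed
  then show ?thesis using ab(2) unfolding consistent_iff_stable by auto
qed

end

theorem theorem6:
  fixes L C R :: "ereal^'n^'n"
  assumes "L \<in> rmax_mats" and "C \<in> rmax_mats" and "R \<in> rmax_mats"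
  defines "n \<equiv> CARD('n)"
    and "K \<equiv> K_mod L C R"
    and "Kstar \<equiv> max_invariant A_bar B_bar (K_mod L C R)"
  shows "((\<forall>k\<ge>n\<^sup>2 - 1. (phi A_bar B_bar ^^ k) K = (phi A_bar B_bar ^^ (n\<^sup>2 - 1)) K) \<and>
            Kstar \<inter> real_vecs \<noteq> {}
          \<longleftrightarrow> consistent L C R) \<and>
         ((\<nexists>k0. \<forall>k\<ge>k0. (phi A_bar B_bar ^^ k) K \<inter> real_vecs
                        = (phi A_bar B_bar ^^ k0) K \<inter> real_vecs) \<and>
            Kstar \<inter> real_vecs = {}
          \<longleftrightarrow> weakly_consistent L C R \<and> \<not> consistent L C R) \<and>
         ((\<exists>k0. \<forall>k\<ge>k0. (phi A_bar B_bar ^^ k) K \<inter> real_vecs = {})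
          \<longleftrightarrow> \<not> weakly_consistent L C R)"
proof -
  interpret max_plus_system L C R using assms(1-3) by unfold_locales
  have empty: "\<exists>k0. \<forall>k\<ge>k0. (phi A_bar B_bar ^^ k) K \<inter> real_vecs = {}" if "\<not> weakly_consistent L C R"
    using that phi_power_real_empty_iff unfolding K_def by blast
  have const: "consistent L C R" if "weakly_consistent L C R"
    "\<exists>k0. \<forall>k\<ge>k0. (phi A_bar B_bar ^^ k) K \<inter> real_vecs = (phi A_bar B_bar ^^ k0) K \<inter> real_vecs"
    using that eventually_constant_imp_consistent unfolding K_def by blast
  have "(\<forall>k\<ge>n\<^sup>2 - 1. (phi A_bar B_bar ^^ k) K = (phi A_bar B_bar ^^ (n\<^sup>2 - 1)) K) \<and>
      Kstar \<inter> real_vecs \<noteq> {} \<longleftrightarrow> consistent L C R"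
    using consistent_imp_phi_power_eq max_invariant_real_iff_consistent
    unfolding K_def Kstar_def n_def by blast
  moreover have "(\<nexists>k0. \<forall>k\<ge>k0. (phi A_bar B_bar ^^ k) K \<inter> real_vecs =
        (phi A_bar B_bar ^^ k0) K \<inter> real_vecs) \<and> Kstar \<inter> real_vecs = {} \<longleftrightarrow>
      weakly_consistent L C R \<and> \<not> consistent L C R"
  proof -
    have "weakly_consistent L C R" if "\<nexists>k0. \<forall>k\<ge>k0. (phi A_bar B_bar ^^ k) K \<inter> real_vecs =
        (phi A_bar B_bar ^^ k0) K \<inter> real_vecs"
      using that empty by (metis order_refl)
    then show ?thesis using const max_invariant_real_iff_consistent unfolding Kstar_def by blast
  qed
  moreover have "(\<exists>k0. \<forall>k\<ge>k0. (phi A_bar B_bar ^^ k) K \<inter> real_vecs = {}) \<longleftrightarrow> \<not> weakly_consistent L C R"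
    using phi_power_real_empty_iff unfolding K_def .
  ultimately show ?thesis by blast
qed

end
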